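(* Let $(\mathfrak g,r')$ be a nondegenerate quasitriangular Lie bialgebra over a field $\mathbb K$ of characteristic $0$. Then the derivation $D_{\mathfrak g^*}^*$ of $\mathcal O_{G^*}$ is inner (Hamiltonian), i.e. there exists a function $h\in\mathcal O_{G^*}$ such that $D_{\mathfrak g^*}^*(f)=\{h,f\}$ for any $f\in\mathcal O_{G^*}$.
   Context: A quasitriangular Lie bialgebra is a pair $(\mathfrak g,r')$ of a Lie algebra $\mathfrak g$ and $r'\in\mathfrak g^{\otimes2}$ with $[r'^{1,2},r'^{1,3}]+[r'^{1,2},r'^{2,3}]+[r'^{1,3},r'^{2,3}]=0$ and $t:=r'+r'^{2,1}\in S^2(\mathfrak g)^{\mathfrak g}$; its cobracket is $x\mapsto[x\otimes1+1\otimes x,(r'-r'^{2,1})/2]$. It is nondegenerate if $\mathfrak g$ is finite dimensional and $t$ is nondegenerate. $\mathfrak g^*$ is the dual Lie bialgebra (bracket dual to the cobracket of $\mathfrak g$, cobracket dual to the bracket of $\mathfrak g$). $G^*$ is the formal Poisson–Lie group with Lie bialgebra $\mathfrak g^*$, with function ring $\mathcal O_{G^*}=U(\mathfrak g^* )^*$ (full dual; product dual to the cocommutative coproduct, Poisson bracket dual to the co-Poisson map $U(\mathfrak g^* )\to\wedge^2U(\mathfrak g^* )$ extending the cobracket of $\mathfrak g^*$). For a finite dimensional Lie bialgebra $(\mathfrak a,\mu_{\mathfrak a},\delta_{\mathfrak a})$, $D_{\mathfrak a}=\mu_{\mathfrak a}\circ\delta_{\mathfrak a}$ (cobracket followed by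 bracket); it is a derivation and coderivation of $\mathfrak a$ and extends to a derivation and coderivation of $U(\mathfrak a)$ (up to normalization of $\mu_{\mathfrak a}\circ\delta_{\mathfrak a}$ by a universal scalar it equals $\hbar^{-1}(S^2-\mathrm{id})_{|\hbar=0}$ for $S$ the antipode of a quantization of $U(\mathfrak a)$; such a scalar does not affect the claim). $D_{\mathfrak g^*}^*$ is the derivation of $\mathcal O_{G^*}=U(\mathfrak g^* )^*$ dual to $D_{\mathfrak g^*}$. *)

theory Defs
  imports
    Complex_Main
    "HOL-Library.Poly_Mapping"
    "HOL-Library.Function_Algebras"
    "HOL-Library.Product_Plus"
begin

section \<open>Vector spaces, duals and tensors\<close>

text \<open>
  Vector spaces are linear subspaces (the carrier) of an ambient type equipped with a scalar
  multiplication, so that a space and its dual are objects of the same kind.  Linear forms on the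
  carrier are extended by zero, which makes equality of forms equality of functions.
\<close>

record ('k, 'v) vspace =
  vcarrier :: "'v set"
  vscale :: "'k \<Rightarrow> 'v \<Rightarrow> 'v"

definition dual_carrier :: "('k::field, 'v::ab_group_add, 'z) vspace_scheme \<Rightarrow> ('v \<Rightarrow> 'k) set" where
  "dual_carrier E = {\<phi>.
     (\<forall>x\<in>vcarrier E. \<forall>y\<in>vcarrier E. \<phi> (x + y) = \<phi> x + \<phi> y) \<and>
     (\<forall>c. \<forall>x\<in>vcarrier E. \<phi> (vscale E c x) = c * \<phi> x) \<and>
     (\<forall>x. x \<notin> vcarrier E \<longrightarrow> \<phi> x = 0)}"

definition dual_space :: "('k::field, 'v::ab_group_add, 'z) vspace_scheme \<Rightarrow> ('k, 'v \<Rightarrow> 'k) vspace" where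
  "dual_space E = \<lparr>vcarrier = dual_carrier E, vscale = (\<lambda>c \<phi> x. c * \<phi> x)\<rparr>"

definition evaluation :: "('k::field, 'v::ab_group_add, 'z) vspace_scheme \<Rightarrow> 'v \<Rightarrow> ('v \<Rightarrow> 'k) \<Rightarrow> 'k" where
  "evaluation E x = (\<lambda>\<phi>. if \<phi> \<in> dual_carrier E then \<phi> x else 0)"

text \<open>
  Over a field the canonical map from \<open>E \<otimes> E\<close> to the bilinear forms on \<open>E\<^sup>* \<times> E\<^sup>*\<close>,
  \<open>x \<otimes> y \<mapsto> ((\<phi>, \<psi>) \<mapsto> \<phi> x * \<psi> y)\<close>, is injective; the tensor square is its image, i.e. the set of
  finite sums of pure tensors.  The same is done for three factors.
\<close>

type_synonym ('k, 'v) tensor2 = "('v \<Rightarrow> 'k) \<Rightarrow> ('v \<Rightarrow> 'k) \<Rightarrow> 'k"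
type_synonym ('k, 'v) tensor3 = "('v \<Rightarrow> 'k) \<Rightarrow> ('v \<Rightarrow> 'k) \<Rightarrow> ('v \<Rightarrow> 'k) \<Rightarrow> 'k"

definition tensor :: "('k::field, 'v::ab_group_add, 'z) vspace_scheme \<Rightarrow> 'v \<Rightarrow> 'v \<Rightarrow> ('k, 'v) tensor2" where
  "tensor E x y = (\<lambda>\<phi> \<psi>. evaluation E x \<phi> * evaluation E y \<psi>)"

definition tensor3 ::
    "('k::field, 'v::ab_group_add, 'z) vspace_scheme \<Rightarrow> 'v \<Rightarrow> 'v \<Rightarrow> 'v \<Rightarrow> ('k, 'v) tensor3" where
  "tensor3 E x y z = (\<lambda>\<phi> \<psi> \<chi>. evaluation E x \<phi> * evaluation E y \<psi> * evaluation E z \<chi>)"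

definition tensor_square :: "('k::field, 'v::ab_group_add, 'z) vspace_scheme \<Rightarrow> ('k, 'v) tensor2 set" where
  "tensor_square E = {\<Sum>(x, y)\<leftarrow>xys. tensor E x y | xys. set xys \<subseteq> vcarrier E \<times> vcarrier E}"

definition tensor_decomp ::
    "('k::field, 'v::ab_group_add, 'z) vspace_scheme \<Rightarrow> ('k, 'v) tensor2 \<Rightarrow> ('v \<times> 'v) list" where
  "tensor_decomp E T =
     (SOME xys. set xys \<subseteq> vcarrier E \<times> vcarrier E \<and> T = (\<Sum>(x, y)\<leftarrow>xys. tensor E x y))"

text \<open>
  The linear map on the tensor square induced by \<open>\<beta>\<close>.  It is used only where \<open>\<beta>\<close> is bilinear
  (possibly after passing to a quotient of its codomain), so that the choice of the decomposition
  does not matter.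
\<close>

definition tensor_lift ::
    "('k::field, 'v::ab_group_add, 'z) vspace_scheme \<Rightarrow> ('v \<Rightarrow> 'v \<Rightarrow> 'w::monoid_add)
       \<Rightarrow> ('k, 'v) tensor2 \<Rightarrow> 'w" where
  "tensor_lift E \<beta> T = (\<Sum>(x, y)\<leftarrow>tensor_decomp E T. \<beta> x y)"

definition flip :: "('k, 'v) tensor2 \<Rightarrow> ('k, 'v) tensor2" where
  "flip T = (\<lambda>\<phi> \<psi>. T \<psi> \<phi>)"


section \<open>Lie algebras and Lie bialgebras\<close>

record ('k, 'v) lie_alg = "('k, 'v) vspace" +
  lie_bracket :: "'v \<Rightarrow> 'v \<Rightarrow> 'v"

record ('k, 'v) lie_bialg = "('k, 'v) lie_alg" +
  lie_cobracket :: "'v \<Rightarrow> ('k, 'v) tensor2"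

locale lie_algebra = vector_space "vscale \<gg>"
  for \<gg> :: "('k::field, 'v::ab_group_add, 'z) lie_alg_scheme" +
  assumes subspace_carrier: "subspace (vcarrier \<gg>)"
    and bracket_closed:
      "\<lbrakk>x \<in> vcarrier \<gg>; y \<in> vcarrier \<gg>\<rbrakk> \<Longrightarrow> lie_bracket \<gg> x y \<in> vcarrier \<gg>"
    and bracket_add_left:
      "\<lbrakk>x \<in> vcarrier \<gg>; y \<in> vcarrier \<gg>; z \<in> vcarrier \<gg>\<rbrakk>
        \<Longrightarrow> lie_bracket \<gg> (x + y) z = lie_bracket \<gg> x z + lie_bracket \<gg> y z"
    and bracket_add_right:
      "\<lbrakk>x \<in> vcarrier \<gg>; y \<in> vcarrier \<gg>; z \<in> vcarrier \<gg>\<rbrakk>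
        \<Longrightarrow> lie_bracket \<gg> x (y + z) = lie_bracket \<gg> x y + lie_bracket \<gg> x z"
    and bracket_scale_left:
      "\<lbrakk>x \<in> vcarrier \<gg>; y \<in> vcarrier \<gg>\<rbrakk>
        \<Longrightarrow> lie_bracket \<gg> (vscale \<gg> c x) y = vscale \<gg> c (lie_bracket \<gg> x y)"
    and bracket_scale_right:
      "\<lbrakk>x \<in> vcarrier \<gg>; y \<in> vcarrier \<gg>\<rbrakk>
        \<Longrightarrow> lie_bracket \<gg> x (vscale \<gg> c y) = vscale \<gg> c (lie_bracket \<gg> x y)"
    and bracket_self: "x \<in> vcarrier \<gg> \<Longrightarrow> lie_bracket \<gg> x x = 0"
    and jacobi:
      "\<lbrakk>x \<in> vcarrier \<gg>; y \<in> vcarrier \<gg>; z \<in> vcarrier \<gg>\<rbrakk>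
        \<Longrightarrow> lie_bracket \<gg> x (lie_bracket \<gg> y z) + lie_bracket \<gg> y (lie_bracket \<gg> z x)
            + lie_bracket \<gg> z (lie_bracket \<gg> x y) = 0"

text \<open>\<open>[x \<otimes> 1 + 1 \<otimes> x, T]\<close>\<close>

definition ad_tensor ::
    "('k::field, 'v::ab_group_add, 'z) lie_alg_scheme \<Rightarrow> 'v \<Rightarrow> ('k, 'v) tensor2 \<Rightarrow> ('k, 'v) tensor2" where
  "ad_tensor \<gg> x T =
     tensor_lift \<gg> (\<lambda>a b. tensor \<gg> (lie_bracket \<gg> x a) b + tensor \<gg> a (lie_bracket \<gg> x b)) T"

text \<open>\<open>[r\<^sup>1\<^sup>2, r\<^sup>1\<^sup>3] + [r\<^sup>1\<^sup>2, r\<^sup>2\<^sup>3] + [r\<^sup>1\<^sup>3, r\<^sup>2\<^sup>3]\<close>, with \<open>a \<otimes> b\<close> running over the first and \<open>c \<otimes> d\<close>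
  over the second copy of \<open>r\<close> in each commutator.\<close>

definition CYB ::
    "('k::field, 'v::ab_group_add, 'z) lie_alg_scheme \<Rightarrow> ('k, 'v) tensor2 \<Rightarrow> ('k, 'v) tensor3" where
  "CYB \<gg> r =
     tensor_lift \<gg> (\<lambda>a b. tensor_lift \<gg> (\<lambda>c d.
         tensor3 \<gg> (lie_bracket \<gg> a c) b d
       + tensor3 \<gg> a (lie_bracket \<gg> b c) d
       + tensor3 \<gg> a c (lie_bracket \<gg> b d)) r) r"

locale quasitriangular_lie_bialgebra = lie_algebra \<gg>
  for \<gg> :: "('k::field, 'v::ab_group_add) lie_alg" and r :: "('k, 'v) tensor2" +
  assumes r_tensor: "r \<in> tensor_square \<gg>"
    and classical_yang_baxter: "CYB \<gg> r = 0"
    and symmetric_part_symmetric: "flip (r + flip r) = r + flip r"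
    and symmetric_part_invariant: "x \<in> vcarrier \<gg> \<Longrightarrow> ad_tensor \<gg> x (r + flip r) = 0"

locale nondegenerate_quasitriangular_lie_bialgebra = quasitriangular_lie_bialgebra +
  assumes finite_dimensional: "\<exists>B. finite B \<and> span B = vcarrier \<gg>"
    and nondegenerate:
      "\<lbrakk>\<phi> \<in> dual_carrier \<gg>; \<forall>\<psi>\<in>dual_carrier \<gg>. (r + flip r) \<phi> \<psi> = 0\<rbrakk> \<Longrightarrow> \<phi> = 0"

definition quasitriangular_bialg ::
    "('k::field, 'v::ab_group_add) lie_alg \<Rightarrow> ('k, 'v) tensor2 \<Rightarrow> ('k, 'v) lie_bialg" where
  "quasitriangular_bialg \<gg> r =
     \<lparr>vcarrier = vcarrier \<gg>, vscale = vscale \<gg>, lie_bracket = lie_bracket \<gg>,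
      lie_cobracket = (\<lambda>x. ad_tensor \<gg> x (\<lambda>\<phi> \<psi>. (r \<phi> \<psi> - flip r \<phi> \<psi>) / 2))\<rparr>"

text \<open>
  Dual of a finite dimensional Lie bialgebra.  The bracket is
  \<open>\<langle>[\<phi>, \<psi>], x\<rangle> = \<langle>\<phi> \<otimes> \<psi>, \<delta> x\<rangle>\<close> (elements of \<open>\<aa> \<otimes> \<aa>\<close> are functions of \<open>(\<phi>, \<psi>)\<close>), and the cobracket of
  \<open>\<chi>\<close> is the element of \<open>\<aa>\<^sup>* \<otimes> \<aa>\<^sup>*\<close> whose pairing with every \<open>x \<otimes> y\<close> is \<open>\<langle>\<chi>, [x, y]\<rangle>\<close>.
\<close>

definition dual_bialg :: "('k::field, 'v::ab_group_add) lie_bialg \<Rightarrow> ('k, 'v \<Rightarrow> 'k) lie_bialg" where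
  "dual_bialg \<aa> =
     \<lparr>vcarrier = vcarrier (dual_space \<aa>), vscale = vscale (dual_space \<aa>),
      lie_bracket = (\<lambda>\<phi> \<psi> x. if x \<in> vcarrier \<aa> then lie_cobracket \<aa> x \<phi> \<psi> else 0),
      lie_cobracket = (\<lambda>\<chi>. THE T. T \<in> tensor_square (dual_space \<aa>) \<and>
         (\<forall>x\<in>vcarrier \<aa>. \<forall>y\<in>vcarrier \<aa>.
            T (evaluation \<aa> x) (evaluation \<aa> y) = \<chi> (lie_bracket \<aa> x y)))\<rparr>"

definition lie_D :: "('k::field, 'v::ab_group_add) lie_bialg \<Rightarrow> 'v \<Rightarrow> 'v" where
  "lie_D \<aa> x = tensor_lift \<aa> (lie_bracket \<aa>) (lie_cobracket \<aa> x)"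


section \<open>The universal enveloping algebra\<close>

text \<open>
  Words form a monoid under concatenation, so \<open>'v list \<Rightarrow>\<^sub>0 'k\<close> is the free associative algebra on the
  set \<open>'v\<close>, and \<open>'v list \<times> 'v list \<Rightarrow>\<^sub>0 'k\<close> is its tensor square as an algebra.
\<close>

instantiation list :: (type) monoid_add
begin
definition zero_list :: "'a list" where "zero_list = []"
definition plus_list :: "'a list \<Rightarrow> 'a list \<Rightarrow> 'a list" where "plus_list = (@)"
instance by standard (simp_all add: zero_list_def plus_list_def)
end

type_synonym ('k, 'v) free_alg = "'v list \<Rightarrow>\<^sub>0 'k"
type_synonym ('k, 'v) free_alg2 = "'v list \<times> 'v list \<Rightarrow>\<^sub>0 'k"

abbreviation word :: "'v list \<Rightarrow> ('k::field, 'v) free_alg" where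
  "word w \<equiv> Poly_Mapping.single w 1"

abbreviation word2 :: "'v list \<Rightarrow> 'v list \<Rightarrow> ('k::field, 'v) free_alg2" where
  "word2 u w \<equiv> Poly_Mapping.single (u, w) 1"

abbreviation const :: "'k::field \<Rightarrow> ('a::monoid_add \<Rightarrow>\<^sub>0 'k)" where
  "const c \<equiv> Poly_Mapping.single 0 c"

definition linear_extension ::
    "('a \<Rightarrow> ('b::monoid_add \<Rightarrow>\<^sub>0 'k::field)) \<Rightarrow> ('a \<Rightarrow>\<^sub>0 'k) \<Rightarrow> ('b \<Rightarrow>\<^sub>0 'k)" where
  "linear_extension F p = (\<Sum>w\<in>Poly_Mapping.keys p. const (Poly_Mapping.lookup p w) * F w)"

inductive_set two_sided_ideal :: "'a::ring_1 set \<Rightarrow> 'a set" for R where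
  zero: "0 \<in> two_sided_ideal R"
| generator: "p \<in> R \<Longrightarrow> a * p * b \<in> two_sided_ideal R"
| add: "p \<in> two_sided_ideal R \<Longrightarrow> q \<in> two_sided_ideal R \<Longrightarrow> p + q \<in> two_sided_ideal R"

text \<open>
  \<open>U(\<aa>)\<close> is the free algebra modulo linearity of the generators and \<open>x y - y x = [x, y]\<close>.  The ambient
  vectors outside the carrier of \<open>\<aa>\<close>, which are also letters, are set to zero.
\<close>

definition uea_relators :: "('k::field, 'v::ab_group_add, 'z) lie_alg_scheme \<Rightarrow> ('k, 'v) free_alg set" where
  "uea_relators \<aa> =
     {word [x + y] - word [x] - word [y] | x y. x \<in> vcarrier \<aa> \<and> y \<in> vcarrier \<aa>}
   \<union> {word [vscale \<aa> c x] - const c * word [x] | c x. x \<in> vcarrier \<aa>}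
   \<union> {word [x] * word [y] - word [y] * word [x] - word [lie_bracket \<aa> x y] | x y.
        x \<in> vcarrier \<aa> \<and> y \<in> vcarrier \<aa>}
   \<union> {word [x] | x. x \<notin> vcarrier \<aa>}"

definition uea_rel :: "('k::field, 'v::ab_group_add, 'z) lie_alg_scheme
    \<Rightarrow> (('k, 'v) free_alg \<times> ('k, 'v) free_alg) set" where
  "uea_rel \<aa> = {(p, q). p - q \<in> two_sided_ideal (uea_relators \<aa>)}"

text \<open>
  The full dual \<open>U(\<aa>)\<^sup>*\<close>: linear forms on the quotient of the free algebra by \<^term>\<open>uea_rel \<aa>\<close>.  For
  \<open>\<aa> = \<gg>\<^sup>*\<close> this is the space of functions on the formal group \<open>G\<^sup>*\<close>.
\<close>

definition uea_dual :: "('k::field, 'v::ab_group_add, 'z) lie_alg_scheme \<Rightarrow> (('k, 'v) free_alg \<Rightarrow> 'k) set" where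
  "uea_dual \<aa> = {f. (\<forall>p q. f (p + q) = f p + f q) \<and> (\<forall>c p. f (const c * p) = c * f p) \<and>
     f respects uea_rel \<aa>}"

text \<open>
  The next maps are given on the free algebra and descend to \<open>U(\<aa>)\<close>: the derivation extending \<open>D\<^sub>\<aa>\<close>,
  the coproduct \<open>\<Delta>\<close>, and the co-Poisson map \<open>\<delta>\<close>, which extends the cobracket by
  \<open>\<delta>(u v) = \<delta>(u) \<Delta>(v) + \<Delta>(u) \<delta>(v)\<close>.  Letters outside the carrier, being zero in \<open>U(\<aa>)\<close>, are
  mapped to zero in the quotient.
\<close>

primrec uea_D_word :: "('k::field, 'v::ab_group_add) lie_bialg \<Rightarrow> 'v list \<Rightarrow> ('k, 'v) free_alg" where
  "uea_D_word \<aa> [] = 0"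
| "uea_D_word \<aa> (x # w) =
     (if x \<in> vcarrier \<aa> then word [lie_D \<aa> x] else 0) * word w + word [x] * uea_D_word \<aa> w"

definition uea_D :: "('k::field, 'v::ab_group_add) lie_bialg \<Rightarrow> ('k, 'v) free_alg \<Rightarrow> ('k, 'v) free_alg" where
  "uea_D \<aa> = linear_extension (uea_D_word \<aa>)"

definition coproduct_letter :: "'v \<Rightarrow> ('k::field, 'v) free_alg2" where
  "coproduct_letter x = word2 [x] [] + word2 [] [x]"

primrec coproduct_word :: "'v list \<Rightarrow> ('k::field, 'v) free_alg2" where
  "coproduct_word [] = 1"
| "coproduct_word (x # w) = coproduct_letter x * coproduct_word w"

definition copoisson_letter :: "('k::field, 'v::ab_group_add) lie_bialg \<Rightarrow> 'v \<Rightarrow> ('k, 'v) free_alg2" where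
  "copoisson_letter \<aa> x =
     (if x \<in> vcarrier \<aa> then tensor_lift \<aa> (\<lambda>a b. word2 [a] [b]) (lie_cobracket \<aa> x) else 0)"

primrec copoisson_word :: "('k::field, 'v::ab_group_add) lie_bialg \<Rightarrow> 'v list \<Rightarrow> ('k, 'v) free_alg2" where
  "copoisson_word \<aa> [] = 0"
| "copoisson_word \<aa> (x # w) =
     copoisson_letter \<aa> x * coproduct_word w + coproduct_letter x * copoisson_word \<aa> w"

definition copoisson :: "('k::field, 'v::ab_group_add) lie_bialg \<Rightarrow> ('k, 'v) free_alg \<Rightarrow> ('k, 'v) free_alg2" where
  "copoisson \<aa> = linear_extension (copoisson_word \<aa>)"

definition form_tensor ::
    "(('k::field, 'v) free_alg \<Rightarrow> 'k) \<Rightarrow> (('k, 'v) free_alg \<Rightarrow> 'k) \<Rightarrow> ('k, 'v) free_alg2 \<Rightarrow> 'k" where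
  "form_tensor f g p =
     (\<Sum>(u, w)\<in>Poly_Mapping.keys p. Poly_Mapping.lookup p (u, w) * (f (word u) * g (word w)))"

definition poisson_bracket :: "('k::field, 'v::ab_group_add) lie_bialg
    \<Rightarrow> (('k, 'v) free_alg \<Rightarrow> 'k) \<Rightarrow> (('k, 'v) free_alg \<Rightarrow> 'k) \<Rightarrow> (('k, 'v) free_alg \<Rightarrow> 'k)" where
  "poisson_bracket \<aa> f g = (\<lambda>u. form_tensor f g (copoisson \<aa> u))"

definition dual_uea_D :: "('k::field, 'v::ab_group_add) lie_bialg
    \<Rightarrow> (('k, 'v) free_alg \<Rightarrow> 'k) \<Rightarrow> (('k, 'v) free_alg \<Rightarrow> 'k)" where
  "dual_uea_D \<aa> f = (\<lambda>u. f (uea_D \<aa> u))"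

end

theory Submission
  imports Defs
begin

text \<open>
  Write \<open>r = \<Sum>a\<^sub>i \<otimes> b\<^sub>i\<close> and \<open>\<rho> = \<Sum>[a\<^sub>i, b\<^sub>i]\<close>.  The Hamiltonian is \<open>h = - \<rho>\<close>, regarded as a linear function
  on \<open>\<gg>\<^sup>*\<close> and then as a primitive function on the formal group \<open>G\<^sup>*\<close>.  The guiding picture is that
  the fourth power of the antipode of a quasitriangular Hopf algebra is conjugation by the grouplike
  element \<open>u S(u)\<^sup>-\<^sup>1\<close>, where \<open>u\<close> is the Drinfeld element.  Up to sign the first order term of this
  element is \<open>\<rho>\<close>, and its being grouplike leaves the trace that \<open>h\<close> is primitive.

  Three facts carry the proof.  First, \<open>\<rho>\<close> has zero cobracket: contracting the first two, or the last
  two, factors of the classical Yang--Baxter equation by the bracket expresses both \<open>- [\<rho> \<otimes> 1, r]\<close> and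
  \<open>[1 \<otimes> \<rho>, r]\<close> as \<open>\<Sum>[a\<^sub>i, a\<^sub>j] \<otimes> [b\<^sub>i, b\<^sub>j]\<close> (\<open>bracket_sum_invariant\<close>).  Therefore \<open>\<phi> \<mapsto> - \<phi> \<rho>\<close> vanishes on
  the brackets of \<open>\<gg>\<^sup>*\<close>, and its extension by zero to words of length other than one descends to
  \<open>U(\<gg>\<^sup>*)\<close> (\<open>primitive_form_in_uea_dual\<close>).

  Second, for a primitive function \<open>h\<close> the operation \<open>{h, -}\<close> is dual to the derivation of the enveloping
  algebra that extends \<open>(h \<otimes> id) \<circ> \<delta>\<close> on generators (\<open>hamiltonian_of_character\<close>): \<open>h\<close> sees only words of length one,
  so in \<open>\<delta> (x\<^sub>1 \<dots> x\<^sub>n) = \<Sum>\<^sub>i \<Delta> x\<^sub>1 \<dots> \<delta> x\<^sub>i \<dots> \<Delta> x\<^sub>n\<close> only the term \<open>1 \<otimes> x\<^sub>j\<close> of each \<open>\<Delta> x\<^sub>j\<close> contributes.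

  Third, on generators this derivation is \<open>D\<close>: the transpose of \<open>D\<close> on \<open>\<gg>\<close> is \<open>\<chi> \<mapsto> \<chi> [-, \<rho>]\<close>, by the Jacobi
  identity, and so is the map \<open>\<chi> \<mapsto> (h \<otimes> id) (\<delta> \<chi>)\<close>, by the definition of the cobracket of \<open>\<gg>\<^sup>*\<close>
  (\<open>dual_lie_D\<close>, \<open>dual_lie_D_character\<close>).
\<close>

section \<open>Additive maps and sums\<close>

lemma additive_sum:
  fixes F :: "'a::ab_group_add \<Rightarrow> 'b::ab_group_add"
  assumes "\<And>p q. F (p + q) = F p + F q"
  shows "F (\<Sum>i\<in>I. p i) = (\<Sum>i\<in>I. F (p i))"
proof -
  have "F 0 + F 0 = F 0 + 0" using assms[of 0 0] by simp
  then have "F 0 = 0" by (simp only: add_left_cancel)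
  then show ?thesis by (induction I rule: infinite_finite_induct) (simp_all add: assms)
qed

lemma additive_sum_list:
  fixes F :: "'a::ab_group_add \<Rightarrow> 'b::ab_group_add"
  assumes "\<And>p q. F (p + q) = F p + F q"
  shows "F (\<Sum>i\<leftarrow>xs. p i) = (\<Sum>i\<leftarrow>xs. F (p i))"
proof -
  have "F 0 + F 0 = F 0 + 0" using assms[of 0 0] by simp
  then have "F 0 = 0" by (simp only: add_left_cancel)
  then show ?thesis by (induction xs) (simp_all add: assms)
qed

lemma sum_list_swap:
  fixes f :: "'a \<Rightarrow> 'b \<Rightarrow> 'c::comm_monoid_add"
  shows "(\<Sum>x\<leftarrow>xs. \<Sum>y\<leftarrow>ys. f x y) = (\<Sum>y\<leftarrow>ys. \<Sum>x\<leftarrow>xs. f x y)"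
  by (induction xs) (simp_all add: sum_list_addf)

lemma sum_list_apply:
  fixes f :: "'a \<Rightarrow> 'b \<Rightarrow> 'c::monoid_add"
  shows "(\<Sum>i\<leftarrow>xs. f i) x = (\<Sum>i\<leftarrow>xs. f i x)"
  by (induction xs) simp_all

lemma sum_apply:
  fixes f :: "'a \<Rightarrow> 'b \<Rightarrow> 'c::comm_monoid_add"
  shows "(\<Sum>i\<in>I. f i) x = (\<Sum>i\<in>I. f i x)"
  by (induction I rule: infinite_finite_induct) simp_all

section \<open>Linear forms on free algebras\<close>

definition extend_form :: "('a \<Rightarrow> 'k::field) \<Rightarrow> ('a \<Rightarrow>\<^sub>0 'k) \<Rightarrow> 'k" where
  "extend_form g p = (\<Sum>w\<in>Poly_Mapping.keys p. Poly_Mapping.lookup p w * g w)"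

lemma extend_form_superset:
  assumes "finite S" "Poly_Mapping.keys p \<subseteq> S"
  shows "extend_form g p = (\<Sum>w\<in>S. Poly_Mapping.lookup p w * g w)"
  unfolding extend_form_def
  by (rule sum.mono_neutral_left) (use assms in \<open>auto simp: in_keys_iff\<close>)

lemma extend_form_add: "extend_form g (p + q) = extend_form g p + extend_form g q"
proof -
  let ?S = "Poly_Mapping.keys p \<union> Poly_Mapping.keys q"
  have "extend_form g s = (\<Sum>w\<in>?S. Poly_Mapping.lookup s w * g w)"
    if "Poly_Mapping.keys s \<subseteq> ?S" for s
    using that by (intro extend_form_superset) auto
  then show ?thesis
    using keys_add[of p q] by (simp add: lookup_add algebra_simps sum.distrib)
qed

lemma extend_form_single [simp]: "extend_form g (Poly_Mapping.single w c) = c * g w"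
  by (cases "c = 0") (auto simp: extend_form_def)

lemma extend_form_0 [simp]: "extend_form g 0 = 0"
  by (simp add: extend_form_def)

lemma poly_mapping_sum_singles:
  "p = (\<Sum>w\<in>Poly_Mapping.keys p. Poly_Mapping.single w (Poly_Mapping.lookup p w))"
  by (rule poly_mapping_eqI) (auto simp: lookup_sum lookup_single when_def in_keys_iff)

text \<open>The conclusion quantifies over \<open>p\<close> so that, when the rule is applied, \<open>F\<close> and \<open>G\<close> are determined
  by higher-order pattern unification.\<close>

lemma additive_eqI:
  fixes F G :: "('a \<Rightarrow>\<^sub>0 'k::field) \<Rightarrow> 'k"
  assumes "\<And>p q. F (p + q) = F p + F q" and "\<And>p q. G (p + q) = G p + G q"
    and "\<And>w c. F (Poly_Mapping.single w c) = G (Poly_Mapping.single w c)"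
  shows "\<forall>p. F p = G p"
proof
  fix p
  have "F p = (\<Sum>w\<in>Poly_Mapping.keys p. F (Poly_Mapping.single w (Poly_Mapping.lookup p w)))"
    by (subst poly_mapping_sum_singles[of p], rule additive_sum) (rule assms)
  also have "\<dots> = (\<Sum>w\<in>Poly_Mapping.keys p. G (Poly_Mapping.single w (Poly_Mapping.lookup p w)))"
    by (simp add: assms(3))
  also have "\<dots> = G p"
    by (subst (3) poly_mapping_sum_singles[of p], rule additive_sum[symmetric]) (rule assms)
  finally show "F p = G p" .
qed

lemma extend_form_const_mult:
  fixes p :: "'a::monoid_add \<Rightarrow>\<^sub>0 'k::field"
  shows "extend_form g (const c * p) = c * extend_form g p"
proof -
  have "\<forall>p :: 'a \<Rightarrow>\<^sub>0 'k. extend_form g (const c * p) = c * extend_form g p"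
    by (rule additive_eqI) (simp_all add: extend_form_add algebra_simps mult_single)
  then show ?thesis by blast
qed

lemma extend_form_diff: "extend_form g (p - q) = extend_form g p - extend_form g q"
  using extend_form_add[of g "p - q" q] by simp

lemma form_tensor_eq: "form_tensor f g = extend_form (\<lambda>(u, w). f (word u) * g (word w))"
  by (auto simp: form_tensor_def extend_form_def fun_eq_iff intro!: sum.cong)

text \<open>Reduces an identity between linear functionals of \<open>linear_extension F\<close> to an identity on words.\<close>

lemma extend_form_linear_extension:
  fixes F :: "'a \<Rightarrow> ('b::monoid_add \<Rightarrow>\<^sub>0 'k::field)"
  assumes "\<And>p q. f (p + q) = f p + f q" and "\<And>c p. f (const c * p) = c * f p"
  shows "f (linear_extension F p) = extend_form (\<lambda>w. f (F w)) p"
  unfolding linear_extension_def extend_form_def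
  by (subst additive_sum[of f]) (simp_all add: assms)

section \<open>Primitive functions on a formal group\<close>

text \<open>A linear form \<open>\<eta>\<close> on \<open>\<aa>\<close> regarded as a function on the formal group: it sees only the degree one
  part of the free algebra.  Letters outside the carrier are zero in \<open>U(\<aa>)\<close>, hence the value zero there.\<close>

definition primitive_form ::
    "('k::field, 'v::ab_group_add, 'z) lie_alg_scheme \<Rightarrow> ('v \<Rightarrow> 'k) \<Rightarrow> ('k, 'v) free_alg \<Rightarrow> 'k" where
  "primitive_form \<aa> \<eta> =
     extend_form (\<lambda>w. case w of [x] \<Rightarrow> if x \<in> vcarrier \<aa> then \<eta> x else 0 | _ \<Rightarrow> 0)"

lemma primitive_form_word:
  "primitive_form \<aa> \<eta> (word []) = 0"
  "primitive_form \<aa> \<eta> (word [x]) = (if x \<in> vcarrier \<aa> then \<eta> x else 0)"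
  "primitive_form \<aa> \<eta> (word (x # y # w)) = 0"
  by (simp_all add: primitive_form_def)

abbreviation counit :: "('k::field, 'v) free_alg \<Rightarrow> 'k" where
  "counit \<equiv> extend_form (\<lambda>w. if w = [] then 1 else 0)"

lemma counit_mult: "counit (p * q) = counit p * counit q"
proof -
  have word: "\<forall>p. counit (p * Poly_Mapping.single v d) = counit p * counit (Poly_Mapping.single v d)"
    for v :: "'b list" and d :: 'a
    by (rule additive_eqI) (auto simp: extend_form_add algebra_simps mult_single plus_list_def)
  have "\<forall>q. counit (p * q) = counit p * counit q"
    by (rule additive_eqI)
      (simp_all only: extend_form_add distrib_left word[rule_format])
  then show ?thesis by blast
qed

text \<open>This is \<open>\<Delta> h = h \<otimes> 1 + 1 \<otimes> h\<close>, the coproduct of functions being dual to the product of \<open>U(\<aa>)\<close>.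
  A product of three factors whose middle factor is killed by both \<open>h\<close> and the counit is therefore
  killed by \<open>h\<close>, which is how \<open>h\<close> descends from the free algebra to \<open>U(\<aa>)\<close>.\<close>

lemma primitive_form_mult:
  "primitive_form \<aa> \<eta> (p * q) = counit p * primitive_form \<aa> \<eta> q + primitive_form \<aa> \<eta> p * counit q"
proof -
  let ?h = "primitive_form \<aa> \<eta>"
  have add: "?h (p + q) = ?h p + ?h q" for p q
    by (simp add: primitive_form_def extend_form_add)
  have word: "\<forall>p. ?h (p * Poly_Mapping.single v d) =
      counit p * ?h (Poly_Mapping.single v d) + ?h p * counit (Poly_Mapping.single v d)" for v d
    by (rule additive_eqI)
      (auto simp: primitive_form_def extend_form_add algebra_simps mult_single plus_list_def
        append_eq_Cons_conv split: list.splits)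
  have "\<forall>q. ?h (p * q) = counit p * ?h q + ?h p * counit q"
  proof (rule additive_eqI)
    show "?h (p * Poly_Mapping.single v d) =
      counit p * ?h (Poly_Mapping.single v d) + ?h p * counit (Poly_Mapping.single v d)" for v d
      using word by blast
  qed (simp_all add: add extend_form_add distrib_left algebra_simps)
  then show ?thesis by blast
qed

text \<open>The relators have counit zero, and \<open>h\<close> vanishes on the commutator relators exactly because \<open>\<eta>\<close> is a
  character: \<open>h\<close> kills words of length two, and \<open>\<eta>\<close> kills brackets.\<close>

lemma primitive_form_in_uea_dual:
  assumes closed: "\<And>x y. x \<in> vcarrier \<aa> \<Longrightarrow> y \<in> vcarrier \<aa> \<Longrightarrow> x + y \<in> vcarrier \<aa>"
      "\<And>c x. x \<in> vcarrier \<aa> \<Longrightarrow> vscale \<aa> c x \<in> vcarrier \<aa>"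
      "\<And>x y. x \<in> vcarrier \<aa> \<Longrightarrow> y \<in> vcarrier \<aa> \<Longrightarrow> lie_bracket \<aa> x y \<in> vcarrier \<aa>"
    and add: "\<And>x y. x \<in> vcarrier \<aa> \<Longrightarrow> y \<in> vcarrier \<aa> \<Longrightarrow> \<eta> (x + y) = \<eta> x + \<eta> y"
    and scale: "\<And>c x. x \<in> vcarrier \<aa> \<Longrightarrow> \<eta> (vscale \<aa> c x) = c * \<eta> x"
    and bracket: "\<And>x y. x \<in> vcarrier \<aa> \<Longrightarrow> y \<in> vcarrier \<aa> \<Longrightarrow> \<eta> (lie_bracket \<aa> x y) = 0"
  shows "primitive_form \<aa> \<eta> \<in> uea_dual \<aa>"
proof -
  let ?h = "primitive_form \<aa> \<eta>"
  have relator: "counit p = 0 \<and> ?h p = 0" if "p \<in> uea_relators \<aa>" for p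
    using that closed add scale bracket unfolding uea_relators_def primitive_form_def
    by (auto simp: extend_form_diff extend_form_const_mult mult_single plus_list_def zero_list_def)
  have "?h p = 0" if "p \<in> two_sided_ideal (uea_relators \<aa>)" for p
    using that
  proof induction
    case (generator p a b)
    then show ?case by (simp add: primitive_form_mult counit_mult relator)
  qed (simp_all add: primitive_form_def extend_form_add)
  then have "?h respects uea_rel \<aa>"
    unfolding congruent_def uea_rel_def primitive_form_def
    by (fastforce simp: extend_form_diff)
  then show ?thesis
    by (simp add: uea_dual_def primitive_form_def extend_form_add extend_form_const_mult)
qed

lemma uea_dual_zero:
  assumes "f \<in> uea_dual \<aa>"
  shows "f 0 = 0"
proof -
  have "f (const 0 * 0) = 0 * f 0"
    using assms unfolding uea_dual_def by blast
  then show ?thesis by simp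
qed

text \<open>This lets inductions on words absorb the first letter into the function.\<close>

lemma uea_dual_left_translate:
  fixes f :: "('k::field, 'v::ab_group_add) free_alg \<Rightarrow> 'k"
  assumes "f \<in> uea_dual \<aa>"
  shows "(\<lambda>p. f (u * p)) \<in> uea_dual \<aa>"
proof -
  have "u * p \<in> two_sided_ideal (uea_relators \<aa>)" if "p \<in> two_sided_ideal (uea_relators \<aa>)"
    for p using that
  proof induction
    case (generator p a b)
    then show ?case
      using two_sided_ideal.generator[of p _ "u * a" b] by (simp add: mult.assoc)
  qed (auto simp: algebra_simps intro: two_sided_ideal.intros)
  moreover have "u * (const c * p) = const c * (u * p)" for c and p :: "('k, 'v) free_alg"
  proof -
    have "\<forall>u :: ('k, 'v) free_alg. Poly_Mapping.lookup (u * const c) w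
        = Poly_Mapping.lookup (const c * u) w" for w
      by (rule additive_eqI) (simp_all add: algebra_simps mult_single lookup_add)
    then have "u * const c = const c * u"
      by (intro poly_mapping_eqI) blast
    then show ?thesis by (simp flip: mult.assoc)
  qed
  ultimately show ?thesis
    using assms by (auto simp: uea_dual_def uea_rel_def congruent_def algebra_simps
        simp flip: right_diff_distrib)
qed

lemma uea_dual_ideal:
  assumes "f \<in> uea_dual \<aa>" "p - q \<in> two_sided_ideal (uea_relators \<aa>)"
  shows "f p = f q"
  using assms by (auto simp: uea_dual_def uea_rel_def congruent_def)

lemma uea_dual_relator:
  assumes "f \<in> uea_dual \<aa>" "p - q \<in> uea_relators \<aa>"
  shows "f (p * w) = f (q * w)"
  using uea_dual_ideal[OF assms(1), of "p * w" "q * w"]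
    two_sided_ideal.generator[OF assms(2), of 1 w] by (simp add: algebra_simps)

lemma
  assumes f: "f \<in> uea_dual \<aa>"
  shows uea_dual_add_letter: "\<lbrakk>x \<in> vcarrier \<aa>; y \<in> vcarrier \<aa>\<rbrakk>
       \<Longrightarrow> f (word [x + y] * w) = f (word [x] * w) + f (word [y] * w)"
    and uea_dual_scale_letter: "x \<in> vcarrier \<aa>
       \<Longrightarrow> f (word [vscale \<aa> c x] * w) = c * f (word [x] * w)"
proof -
  have lin: "f (p + q) = f p + f q" "f (const c * p) = c * f p" for p q c
    using f by (auto simp: uea_dual_def)
  show "f (word [x + y] * w) = f (word [x] * w) + f (word [y] * w)"
    if "x \<in> vcarrier \<aa>" "y \<in> vcarrier \<aa>"
    using uea_dual_relator[OF f, of "word [x + y]" "word [x] + word [y]" w] that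
    by (force simp: uea_relators_def lin algebra_simps)
  show "f (word [vscale \<aa> c x] * w) = c * f (word [x] * w)" if "x \<in> vcarrier \<aa>"
    using uea_dual_relator[OF f, of "word [vscale \<aa> c x]" "const c * word [x]" w] that
    by (force simp: uea_relators_def lin mult.assoc)
qed

section \<open>Hamiltonian vector fields of primitive functions\<close>

text \<open>A first tensor factor that begins with two letters stays of length at least two under further
  multiplication, and a primitive function ignores such words.\<close>

lemma form_tensor_mult_long:
  "form_tensor (primitive_form \<aa> \<eta>) f (word2 (x # y # u) v * p) = 0"
proof -
  have "\<forall>p. form_tensor (primitive_form \<aa> \<eta>) f (word2 (x # y # u) v * p) = 0"
    by (rule additive_eqI[where G = "\<lambda>_. 0"])
      (auto simp: form_tensor_eq extend_form_add algebra_simps mult_single plus_list_def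
        primitive_form_word)
  then show ?thesis by blast
qed

lemma form_tensor_translate:
  "form_tensor h f (word2 [] u * p) = form_tensor h (\<lambda>q. f (word u * q)) p"
proof -
  have "\<forall>p. form_tensor h f (word2 [] u * p) = form_tensor h (\<lambda>q. f (word u * q)) p"
    by (rule additive_eqI)
      (auto simp: form_tensor_eq extend_form_add algebra_simps mult_single plus_list_def)
  then show ?thesis by blast
qed

lemma form_tensor_add: "form_tensor h f (p + q) = form_tensor h f p + form_tensor h f q"
  by (simp add: form_tensor_eq extend_form_add)

lemma word2_mult: "word2 a b * (word2 c d * p) = word2 (a @ c) (b @ d) * p"
  by (simp add: mult_single plus_list_def flip: mult.assoc)

text \<open>Only the term \<open>1 \<otimes> w\<close> of \<open>\<Delta> w\<close> leaves the first factor at length one.\<close>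

lemma form_tensor_coproduct:
  "form_tensor (primitive_form \<aa> \<eta>) f (word2 [a] v * coproduct_word w)
     = primitive_form \<aa> \<eta> (word [a]) * f (word (v @ w))"
proof (induction w arbitrary: v)
  case Nil
  show ?case by (simp add: form_tensor_eq)
next
  case (Cons y w)
  then show ?case
    by (simp add: coproduct_letter_def distrib_left distrib_right word2_mult form_tensor_add
        form_tensor_mult_long)
qed

lemma form_tensor_mult_copoisson_letter:
  "form_tensor h f (p * copoisson_letter \<aa> x * q) = (if x \<in> vcarrier \<aa> then
     (\<Sum>(a, b)\<leftarrow>tensor_decomp \<aa> (lie_cobracket \<aa> x). form_tensor h f (p * word2 [a] [b] * q)) else 0)"
proof -
  have "form_tensor h f (p * (\<Sum>(a, b)\<leftarrow>xs. word2 [a] [b]) * q)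
      = (\<Sum>(a, b)\<leftarrow>xs. form_tensor h f (p * word2 [a] [b] * q))" for xs
    by (induction xs) (auto simp: form_tensor_add distrib_left distrib_right, simp add: form_tensor_eq)
  then show ?thesis
    by (simp add: copoisson_letter_def tensor_lift_def) (simp add: form_tensor_eq)
qed

text \<open>Every term of \<open>\<delta> w\<close> has a nonempty first factor, as it contains a letter coming from the cobracket;
  one more letter in front makes it too long for a primitive function.\<close>

lemma form_tensor_copoisson_word_shifted:
  "form_tensor (primitive_form \<aa> \<eta>) f (word2 [x] v * copoisson_word \<bb> w) = 0"
proof (induction w arbitrary: v)
  case Nil
  show ?case by (simp add: form_tensor_eq)
next
  case (Cons y w)
  have "form_tensor (primitive_form \<aa> \<eta>) f (word2 [x] v * copoisson_letter \<bb> y * coproduct_word w) = 0"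
    unfolding form_tensor_mult_copoisson_letter
    by (auto simp: mult.assoc word2_mult form_tensor_mult_long case_prod_unfold)
  with Cons show ?case
    by (simp add: coproduct_letter_def distrib_left distrib_right word2_mult form_tensor_add
        form_tensor_mult_long mult.assoc)
qed

text \<open>In \<open>\<delta> (x w) = \<delta> x \<Delta> w + \<Delta> x \<delta> w\<close> the first term contributes \<open>((\<eta> \<otimes> id) \<delta> x) w\<close>, which is \<open>D x w\<close> in
  \<open>U(\<aa>)\<close> by hypothesis; in the second only \<open>1 \<otimes> x\<close> survives and gives \<open>x D w\<close> by induction.  So the
  Hamiltonian vector field of the primitive function obeys the recursion that defines \<open>D\<close>.\<close>

lemma hamiltonian_word:
  assumes zero: "0 \<in> vcarrier \<aa>"
    and add: "\<And>x y. x \<in> vcarrier \<aa> \<Longrightarrow> y \<in> vcarrier \<aa> \<Longrightarrow> x + y \<in> vcarrier \<aa>"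
    and scale: "\<And>c x. x \<in> vcarrier \<aa> \<Longrightarrow> vscale \<aa> c x \<in> vcarrier \<aa>"
    and decomp: "\<And>x. x \<in> vcarrier \<aa> \<Longrightarrow>
      set (tensor_decomp \<aa> (lie_cobracket \<aa> x)) \<subseteq> vcarrier \<aa> \<times> vcarrier \<aa>"
    and D: "\<And>x. x \<in> vcarrier \<aa> \<Longrightarrow>
      lie_D \<aa> x = (\<Sum>(a, b)\<leftarrow>tensor_decomp \<aa> (lie_cobracket \<aa> x). vscale \<aa> (\<eta> a) b)"
    and f: "f \<in> uea_dual \<aa>"
  shows "f (uea_D_word \<aa> w) = form_tensor (primitive_form \<aa> \<eta>) f (copoisson_word \<aa> w)"
  using f
proof (induction w arbitrary: f)
  case Nil
  then show ?case by (simp add: form_tensor_eq uea_dual_zero)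
next
  case (Cons x w)
  let ?h = "primitive_form \<aa> \<eta>"
  have lin: "f (p + q) = f p + f q" for p q
    using Cons.prems by (auto simp: uea_dual_def)
  have z: "f (word [0] * p) = 0" for p
  proof -
    have "f (word [0] * p) + f (word [0] * p) = f (word [0] * p) + 0"
      using uea_dual_add_letter[OF Cons.prems zero zero, of p] by simp
    then show ?thesis by (simp only: add_left_cancel)
  qed
  have sum_letter: "f (word [\<Sum>(a, b)\<leftarrow>xs. vscale \<aa> (\<eta> a) b] * p)
        = (\<Sum>(a, b)\<leftarrow>xs. \<eta> a * f (word [b] * p))
      \<and> (\<Sum>(a, b)\<leftarrow>xs. vscale \<aa> (\<eta> a) b) \<in> vcarrier \<aa>"
    if "set xs \<subseteq> vcarrier \<aa> \<times> vcarrier \<aa>" for xs p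
    using that
    by (induction xs) (auto simp: z zero add scale
        uea_dual_add_letter[OF Cons.prems] uea_dual_scale_letter[OF Cons.prems])
  \<comment> \<open>\<open>D x\<close> and \<open>(\<eta> \<otimes> id) \<delta> x\<close> agree as single letters, whereas the copoisson map yields a linear
    combination of letters; linearity of \<open>f\<close> modulo the relators reconciles the two.\<close>
  have letter: "f (word [lie_D \<aa> x] * word w)
      = form_tensor ?h f (copoisson_letter \<aa> x * coproduct_word w)" if x: "x \<in> vcarrier \<aa>"
  proof -
    let ?xs = "tensor_decomp \<aa> (lie_cobracket \<aa> x)"
    have "f (word [lie_D \<aa> x] * word w) = (\<Sum>(a, b)\<leftarrow>?xs. \<eta> a * f (word [b] * word w))"
      unfolding D[OF x] using sum_letter[OF decomp[OF x]] by blast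
    also have "\<dots> = (\<Sum>(a, b)\<leftarrow>?xs. form_tensor ?h f (word2 [a] [b] * coproduct_word w))"
      unfolding form_tensor_coproduct using decomp[OF x]
      by (intro arg_cong[where f = sum_list] map_cong)
        (auto simp: primitive_form_word mult_single plus_list_def)
    also have "\<dots> = form_tensor ?h f (copoisson_letter \<aa> x * coproduct_word w)"
      using form_tensor_mult_copoisson_letter[of ?h f 1 \<aa> x] x by simp
    finally show ?thesis .
  qed
  have "form_tensor ?h f (copoisson_letter \<aa> x * coproduct_word w)
      = f ((if x \<in> vcarrier \<aa> then word [lie_D \<aa> x] else 0) * word w)"
    using letter by (auto simp: copoisson_letter_def uea_dual_zero[OF Cons.prems]) (simp add: form_tensor_eq)
  moreover have "form_tensor ?h f (coproduct_letter x * copoisson_word \<aa> w)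
      = f (word [x] * uea_D_word \<aa> w)"
    using Cons.IH[OF uea_dual_left_translate[OF Cons.prems, of "word [x]"]]
    by (simp add: coproduct_letter_def distrib_right form_tensor_add
        form_tensor_copoisson_word_shifted form_tensor_translate)
  ultimately show ?case
    by (simp add: lin form_tensor_add)
qed

lemma hamiltonian_of_character:
  assumes "0 \<in> vcarrier \<aa>"
    and "\<And>x y. x \<in> vcarrier \<aa> \<Longrightarrow> y \<in> vcarrier \<aa> \<Longrightarrow> x + y \<in> vcarrier \<aa>"
    and "\<And>c x. x \<in> vcarrier \<aa> \<Longrightarrow> vscale \<aa> c x \<in> vcarrier \<aa>"
    and "\<And>x. x \<in> vcarrier \<aa> \<Longrightarrow>
      set (tensor_decomp \<aa> (lie_cobracket \<aa> x)) \<subseteq> vcarrier \<aa> \<times> vcarrier \<aa>"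
    and "\<And>x. x \<in> vcarrier \<aa> \<Longrightarrow>
      lie_D \<aa> x = (\<Sum>(a, b)\<leftarrow>tensor_decomp \<aa> (lie_cobracket \<aa> x). vscale \<aa> (\<eta> a) b)"
    and f: "f \<in> uea_dual \<aa>"
  shows "dual_uea_D \<aa> f = poisson_bracket \<aa> (primitive_form \<aa> \<eta>) f"
proof
  fix u
  let ?h = "primitive_form \<aa> \<eta>"
  have "f (uea_D \<aa> u) = extend_form (\<lambda>w. f (uea_D_word \<aa> w)) u"
    unfolding uea_D_def by (rule extend_form_linear_extension) (use f in \<open>auto simp: uea_dual_def\<close>)
  also have "\<dots> = extend_form (\<lambda>w. form_tensor ?h f (copoisson_word \<aa> w)) u"
    using hamiltonian_word[OF assms] by simp
  also have "\<dots> = form_tensor ?h f (copoisson \<aa> u)"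
    unfolding copoisson_def
    by (rule extend_form_linear_extension[symmetric])
      (simp_all add: form_tensor_eq extend_form_add extend_form_const_mult)
  finally show "dual_uea_D \<aa> f u = poisson_bracket \<aa> ?h f u"
    by (simp add: dual_uea_D_def poisson_bracket_def)
qed

section \<open>Tensor squares of finite dimensional spaces\<close>

locale carrier_space = vector_space "vscale E"
  for E :: "('k::field, 'v::ab_group_add, 'z) vspace_scheme" +
  assumes subspace_carrier: "subspace (vcarrier E)"
begin

lemma carrier_0: "0 \<in> vcarrier E"
  and carrier_add: "x \<in> vcarrier E \<Longrightarrow> y \<in> vcarrier E \<Longrightarrow> x + y \<in> vcarrier E"
  and carrier_scale: "x \<in> vcarrier E \<Longrightarrow> vscale E c x \<in> vcarrier E"
  using subspace_carrier by (auto simp: subspace_def)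

lemmas carrier_intros = carrier_0 carrier_add carrier_scale

text \<open>Unlike members of \<^const>\<open>dual_carrier\<close>, these forms may take any values outside the carrier, so that
  expressions such as \<open>\<lambda>x. \<phi> [x, z]\<close> qualify.\<close>

definition linear_on :: "('v \<Rightarrow> 'k) \<Rightarrow> bool" where
  "linear_on \<phi> \<longleftrightarrow> (\<forall>x\<in>vcarrier E. \<forall>y\<in>vcarrier E. \<phi> (x + y) = \<phi> x + \<phi> y) \<and>
     (\<forall>c. \<forall>x\<in>vcarrier E. \<phi> (vscale E c x) = c * \<phi> x)"

definition bilinear_on :: "('v \<Rightarrow> 'v \<Rightarrow> 'k) \<Rightarrow> bool" where
  "bilinear_on \<beta> \<longleftrightarrow> (\<forall>x\<in>vcarrier E. linear_on (\<beta> x) \<and> linear_on (\<lambda>y. \<beta> y x))"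

lemma dual_linear_on: "\<phi> \<in> dual_carrier E \<Longrightarrow> linear_on \<phi>"
  by (simp add: dual_carrier_def linear_on_def)

lemma linear_on_0: "linear_on \<phi> \<Longrightarrow> \<phi> 0 = 0"
  using carrier_0 scale_zero_left[of 0] unfolding linear_on_def by (metis mult_zero_left)

lemma linear_on_sum_list:
  assumes "set xs \<subseteq> vcarrier E"
  shows "sum_list xs \<in> vcarrier E" "linear_on \<phi> \<Longrightarrow> \<phi> (sum_list xs) = (\<Sum>x\<leftarrow>xs. \<phi> x)"
proof -
  show in_carrier: "sum_list xs \<in> vcarrier E"
    using assms by (induction xs) (auto intro: carrier_intros)
  have "linear_on \<phi> \<Longrightarrow> sum_list xs \<in> vcarrier E \<and> \<phi> (sum_list xs) = (\<Sum>x\<leftarrow>xs. \<phi> x)"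
    using assms by (induction xs) (auto simp: linear_on_0 intro: carrier_intros, simp add: linear_on_def)
  then show "linear_on \<phi> \<Longrightarrow> \<phi> (sum_list xs) = (\<Sum>x\<leftarrow>xs. \<phi> x)" by blast
qed

lemma linear_on_sum:
  assumes "finite I" "linear_on \<phi>" "\<And>i. i \<in> I \<Longrightarrow> x i \<in> vcarrier E"
  shows "\<phi> (\<Sum>i\<in>I. x i) = (\<Sum>i\<in>I. \<phi> (x i))"
proof -
  have "(\<Sum>i\<in>I. x i) \<in> vcarrier E \<and> \<phi> (\<Sum>i\<in>I. x i) = (\<Sum>i\<in>I. \<phi> (x i))"
    using assms
    by (induction I) (auto simp: linear_on_0 intro: carrier_intros, simp add: linear_on_def)
  then show ?thesis by blast
qed

lemma dual_carrier_space: "carrier_space (dual_space E)"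
proof -
  interpret D: vector_space "\<lambda>c (\<phi> :: 'v \<Rightarrow> 'k) x. c * \<phi> x"
    by standard (simp_all add: fun_eq_iff algebra_simps)
  have "D.subspace (dual_carrier E)"
    by (auto simp: D.subspace_def dual_carrier_def distrib_left)
  then show ?thesis
    unfolding carrier_space_def carrier_space_axioms_def
    using D.vector_space_axioms by (simp add: dual_space_def)
qed

lemma evaluation_dual: "\<phi> \<in> dual_carrier E \<Longrightarrow> evaluation E x \<phi> = \<phi> x"
  by (simp add: evaluation_def)

lemma evaluation_in_double_dual:
  assumes "x \<in> vcarrier E"
  shows "evaluation E x \<in> dual_carrier (dual_space E)"
proof -
  have "carrier_space (dual_space E)" by (rule dual_carrier_space)
  from carrier_space.carrier_intros[OF this]
  show ?thesis
    by (auto simp: evaluation_def dual_carrier_def[of "dual_space E"])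
      (auto simp: dual_space_def)
qed

lemma tensor_dual:
  "\<lbrakk>\<phi> \<in> dual_carrier E; \<psi> \<in> dual_carrier E\<rbrakk> \<Longrightarrow> tensor E x y \<phi> \<psi> = \<phi> x * \<psi> y"
  by (simp add: tensor_def evaluation_dual)

lemma tensor_outside:
  "\<phi> \<notin> dual_carrier E \<or> \<psi> \<notin> dual_carrier E \<Longrightarrow> tensor E x y \<phi> \<psi> = 0"
  by (auto simp: tensor_def evaluation_def)

lemma tensor_square_tensor: "x \<in> vcarrier E \<Longrightarrow> y \<in> vcarrier E \<Longrightarrow> tensor E x y \<in> tensor_square E"
  unfolding tensor_square_def by (rule CollectI, rule exI[of _ "[(x, y)]"]) simp

lemma tensor_square_0: "0 \<in> tensor_square E"
  unfolding tensor_square_def by (rule CollectI, rule exI[of _ "[]"]) simp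

lemma tensor_square_add:
  assumes "S \<in> tensor_square E" "T \<in> tensor_square E"
  shows "S + T \<in> tensor_square E"
proof -
  from assms obtain xs ys where "set xs \<subseteq> vcarrier E \<times> vcarrier E"
      "set ys \<subseteq> vcarrier E \<times> vcarrier E"
      "S = (\<Sum>(x, y)\<leftarrow>xs. tensor E x y)" "T = (\<Sum>(x, y)\<leftarrow>ys. tensor E x y)"
    unfolding tensor_square_def by blast
  then show ?thesis
    unfolding tensor_square_def by (intro CollectI exI[of _ "xs @ ys"]) simp
qed

lemma tensor_square_sum:
  "(\<And>i. i \<in> I \<Longrightarrow> T i \<in> tensor_square E) \<Longrightarrow> (\<Sum>i\<in>I. T i) \<in> tensor_square E"
  by (induction I rule: infinite_finite_induct)
    (auto intro: tensor_square_0 tensor_square_add)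

lemma tensor_square_sum_list:
  "(\<And>i. i \<in> set xs \<Longrightarrow> T i \<in> tensor_square E) \<Longrightarrow> (\<Sum>i\<leftarrow>xs. T i) \<in> tensor_square E"
  by (induction xs) (auto intro: tensor_square_0 tensor_square_add)

lemma tensor_decomp:
  assumes "T \<in> tensor_square E"
  shows "set (tensor_decomp E T) \<subseteq> vcarrier E \<times> vcarrier E"
    and "T = (\<Sum>(x, y)\<leftarrow>tensor_decomp E T. tensor E x y)"
proof -
  have "\<exists>xys. set xys \<subseteq> vcarrier E \<times> vcarrier E \<and> T = (\<Sum>(x, y)\<leftarrow>xys. tensor E x y)"
    using assms unfolding tensor_square_def by blast
  from someI_ex[OF this]
  show "set (tensor_decomp E T) \<subseteq> vcarrier E \<times> vcarrier E"
      "T = (\<Sum>(x, y)\<leftarrow>tensor_decomp E T. tensor E x y)"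
    unfolding tensor_decomp_def by blast+
qed

text \<open>The factor one half and the sign are absorbed by the first tensor factor.\<close>

lemma tensor_square_antisymmetrize:
  assumes "T \<in> tensor_square E"
  shows "(\<lambda>\<phi> \<psi>. (T \<phi> \<psi> - flip T \<phi> \<psi>) / 2) \<in> tensor_square E"
proof -
  obtain xs where T: "set xs \<subseteq> vcarrier E \<times> vcarrier E" "T = (\<Sum>(x, y)\<leftarrow>xs. tensor E x y)"
    using assms unfolding tensor_square_def by blast
  have eq: "(\<lambda>\<phi> \<psi>. (T \<phi> \<psi> - flip T \<phi> \<psi>) / 2) =
     (\<Sum>(x, y)\<leftarrow>xs. tensor E (vscale E (1/2) x) y + tensor E (vscale E (-1/2) y) x)"
  proof (intro ext)
    fix \<phi> \<psi>
    have half: "(tensor E x y \<phi> \<psi> - tensor E x y \<psi> \<phi>) / 2 =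
      (tensor E (vscale E (1/2) x) y + tensor E (vscale E (-1/2) y) x) \<phi> \<psi>"
      if "x \<in> vcarrier E" "y \<in> vcarrier E" for x y
    proof (cases "\<phi> \<in> dual_carrier E \<and> \<psi> \<in> dual_carrier E")
      case True
      then have "\<phi> (vscale E c z) = c * \<phi> z" "\<psi> (vscale E c z) = c * \<psi> z"
        if "z \<in> vcarrier E" for c z
        using that by (auto simp: dual_carrier_def)
      with True that show ?thesis by (simp add: tensor_dual algebra_simps diff_divide_distrib del: scale_minus_left)
    qed (auto simp: tensor_outside)
    have "(T \<phi> \<psi> - T \<psi> \<phi>) / 2 = (\<Sum>(x, y)\<leftarrow>xs. (tensor E x y \<phi> \<psi> - tensor E x y \<psi> \<phi>) / 2)"
    proof -
      have "((\<Sum>(x, y)\<leftarrow>xs. tensor E x y) \<phi> \<psi> - (\<Sum>(x, y)\<leftarrow>xs. tensor E x y) \<psi> \<phi>) / 2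
        = (\<Sum>(x, y)\<leftarrow>xs. (tensor E x y \<phi> \<psi> - tensor E x y \<psi> \<phi>) / 2)" for xs
        by (induction xs) (auto simp: add_divide_distrib diff_divide_distrib)
      then show ?thesis by (simp only: T(2))
    qed
    also have "\<dots> = (\<Sum>(x, y)\<leftarrow>xs. (tensor E (vscale E (1/2) x) y + tensor E (vscale E (-1/2) y) x) \<phi> \<psi>)"
      unfolding case_prod_unfold
      by (intro arg_cong[where f = sum_list] map_cong refl half) (auto dest!: subsetD[OF T(1)])
    finally show "(T \<phi> \<psi> - flip T \<phi> \<psi>) / 2 =
      (\<Sum>(x, y)\<leftarrow>xs. tensor E (vscale E (1/2) x) y + tensor E (vscale E (-1/2) y) x) \<phi> \<psi>"
      by (simp add: flip_def sum_list_apply case_prod_unfold)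
  qed
  show ?thesis
    unfolding eq using T(1)
    by (intro tensor_square_sum_list)
      (auto intro!: tensor_square_add tensor_square_tensor carrier_scale subspace_neg[OF subspace_carrier])
qed

end

locale finite_dimensional_space = carrier_space E
  for E :: "('k::field, 'v::ab_group_add, 'z) vspace_scheme" +
  assumes finite_spanning: "\<exists>B. finite B \<and> span B = vcarrier E"
begin

definition basis :: "'v set" where
  "basis = (SOME B. finite B \<and> independent B \<and> span B = vcarrier E)"

lemma basis: "finite basis" "independent basis" "span basis = vcarrier E"
proof -
  obtain S where S: "finite S" "span S = vcarrier E" using finite_spanning by blast
  obtain B where B: "B \<subseteq> vcarrier E" "independent B" "vcarrier E \<subseteq> span B"
    by (rule maximal_independent_subset)
  have "finite B" using independent_span_bound[OF S(1) B(2)] B(1) S(2) by auto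
  moreover have "span B = vcarrier E"
    using B(1,3) span_minimal[OF B(1) subspace_carrier] by blast
  ultimately have "\<exists>B. finite B \<and> independent B \<and> span B = vcarrier E"
    using B(2) by blast
  from someI_ex[OF this] show "finite basis" "independent basis" "span basis = vcarrier E"
    unfolding basis_def by blast+
qed

lemma basis_carrier: "b \<in> basis \<Longrightarrow> b \<in> vcarrier E"
  using basis(3) span_base by blast

definition coord :: "'v \<Rightarrow> 'v \<Rightarrow> 'k" where
  "coord b x = (if x \<in> vcarrier E then representation basis x b else 0)"

lemma coord_dual: "coord b \<in> dual_carrier E"
  using basis
  by (auto simp: coord_def dual_carrier_def carrier_intros representation_add representation_scale)

lemma coord_expansion:
  assumes "linear_on \<phi>" "x \<in> vcarrier E"
  shows "\<phi> x = (\<Sum>b\<in>basis. coord b x * \<phi> b)"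
proof -
  have "x = (\<Sum>b\<in>basis. vscale E (coord b x) b)"
    using sum_representation_eq[OF basis(2) _ basis(1) subset_refl, of x] assms basis
    by (simp add: coord_def)
  then have "\<phi> x = \<phi> (\<Sum>b\<in>basis. vscale E (coord b x) b)" by simp
  also have "\<dots> = (\<Sum>b\<in>basis. \<phi> (vscale E (coord b x) b))"
    using assms basis by (intro linear_on_sum) (auto intro: carrier_scale basis_carrier)
  also have "\<dots> = (\<Sum>b\<in>basis. coord b x * \<phi> b)"
    using assms by (auto simp: linear_on_def basis_carrier)
  finally show ?thesis .
qed

lemma bilinear_expansion:
  assumes "bilinear_on \<beta>" "x \<in> vcarrier E" "y \<in> vcarrier E"
  shows "\<beta> x y = (\<Sum>b\<in>basis. \<Sum>c\<in>basis. \<beta> b c * (coord b x * coord c y))"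
proof -
  have "\<beta> x y = (\<Sum>b\<in>basis. coord b x * \<beta> b y)"
    using assms by (intro coord_expansion) (auto simp: bilinear_on_def)
  also have "\<dots> = (\<Sum>b\<in>basis. coord b x * (\<Sum>c\<in>basis. coord c y * \<beta> b c))"
    using assms by (intro sum.cong refl arg_cong2[where f = "(*)"] coord_expansion)
      (auto simp: bilinear_on_def basis_carrier)
  finally show ?thesis by (simp add: sum_distrib_left mult_ac)
qed

text \<open>The linear form on the tensor square induced by a bilinear form \<open>\<beta>\<close>.  Written in coordinates its value
  depends on \<open>T\<close> alone and not on a decomposition of \<open>T\<close>, which makes the choice of a decomposition in \<^const>\<open>tensor_lift\<close> irrelevant.\<close>

definition contract :: "('v \<Rightarrow> 'v \<Rightarrow> 'k) \<Rightarrow> ('k, 'v) tensor2 \<Rightarrow> 'k" where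
  "contract \<beta> T = (\<Sum>b\<in>basis. \<Sum>c\<in>basis. \<beta> b c * T (coord b) (coord c))"

lemma contract_tensor:
  assumes "bilinear_on \<beta>" "x \<in> vcarrier E" "y \<in> vcarrier E"
  shows "contract \<beta> (tensor E x y) = \<beta> x y"
  unfolding contract_def by (subst bilinear_expansion[OF assms]) (simp add: tensor_dual coord_dual)

lemma contract_add: "contract \<beta> (S + T) = contract \<beta> S + contract \<beta> T"
  by (simp add: contract_def algebra_simps sum.distrib)

lemma contract_decomp:
  assumes "bilinear_on \<beta>" "T \<in> tensor_square E"
  shows "(\<Sum>(x, y)\<leftarrow>tensor_decomp E T. \<beta> x y) = contract \<beta> T"
proof -
  define xs where "xs = tensor_decomp E T"
  note T = tensor_decomp[OF assms(2), folded xs_def]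
  have "contract \<beta> T = (\<Sum>p\<leftarrow>xs. contract \<beta> (tensor E (fst p) (snd p)))"
    unfolding T(2) case_prod_unfold
    by (rule additive_sum_list[of "contract \<beta>"]) (rule contract_add)
  also have "\<dots> = (\<Sum>(x, y)\<leftarrow>xs. \<beta> x y)"
    using T(1) assms(1) by (intro arg_cong[where f = sum_list] map_cong) (auto intro!: contract_tensor)
  finally show ?thesis by (simp add: xs_def)
qed

lemma contract_antisymmetrize:
  "contract \<beta> (\<lambda>\<phi> \<psi>. (T \<phi> \<psi> - flip T \<phi> \<psi>) / 2)
     = (contract \<beta> T - contract (\<lambda>x y. \<beta> y x) T) / 2"
proof -
  have "contract (\<lambda>x y. \<beta> y x) T = (\<Sum>b\<in>basis. \<Sum>c\<in>basis. \<beta> b c * flip T (coord b) (coord c))"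
    unfolding contract_def flip_def by (rule sum.swap)
  then show ?thesis
    by (simp add: contract_def algebra_simps diff_divide_distrib sum_subtractf sum_divide_distrib)
qed

text \<open>Reflexivity: \<open>\<Phi>\<close> is evaluation at the vector with coordinates \<open>\<Phi> (coord b)\<close>.\<close>

lemma double_dual:
  assumes "\<Phi> \<in> dual_carrier (dual_space E)"
  obtains x where "x \<in> vcarrier E" "\<Phi> = evaluation E x"
proof -
  interpret D: carrier_space "dual_space E" by (rule dual_carrier_space)
  let ?x = "\<Sum>b\<in>basis. vscale E (\<Phi> (coord b)) b"
  have x: "?x \<in> vcarrier E"
    using subspace_carrier by (intro subspace_sum) (auto intro: carrier_scale basis_carrier)
  have "\<Phi> \<phi> = evaluation E ?x \<phi>" for \<phi>
  proof (cases "\<phi> \<in> dual_carrier E")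
    case False
    then show ?thesis
      using assms by (simp add: evaluation_def dual_carrier_def[of "dual_space E"])
        (simp add: dual_space_def)
  next
    case True
    have "\<phi> y = (\<Sum>b\<in>basis. vscale (dual_space E) (\<phi> b) (coord b)) y" for y
    proof (cases "y \<in> vcarrier E")
      case True
      then show ?thesis
        using coord_expansion[OF dual_linear_on[OF \<open>\<phi> \<in> dual_carrier E\<close>] True]
        by (simp add: sum_apply dual_space_def mult.commute)
    next
      case False
      then show ?thesis
        using True by (simp add: sum_apply dual_space_def coord_def dual_carrier_def)
    qed
    then have "\<phi> = (\<Sum>b\<in>basis. vscale (dual_space E) (\<phi> b) (coord b))" by blast
    then have "\<Phi> \<phi> = \<Phi> (\<Sum>b\<in>basis. vscale (dual_space E) (\<phi> b) (coord b))" by simp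
    also have "\<dots> = (\<Sum>b\<in>basis. \<Phi> (vscale (dual_space E) (\<phi> b) (coord b)))"
      using basis(1) D.dual_linear_on[OF assms]
      by (rule D.linear_on_sum) (auto intro!: D.carrier_scale, simp add: dual_space_def coord_dual)
    also have "\<dots> = (\<Sum>b\<in>basis. \<phi> b * \<Phi> (coord b))"
      using D.dual_linear_on[OF assms] coord_dual
      by (auto simp: D.linear_on_def) (simp add: dual_space_def)
    also have "\<dots> = (\<Sum>b\<in>basis. \<phi> (vscale E (\<Phi> (coord b)) b))"
      using dual_linear_on[OF True] by (auto simp: linear_on_def basis_carrier mult.commute)
    also have "\<dots> = \<phi> ?x"
      using basis(1) dual_linear_on[OF True]
      by (intro linear_on_sum[symmetric]) (auto intro: carrier_scale basis_carrier)
    finally show ?thesis using True by (simp add: evaluation_dual)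
  qed
  then show thesis using that x by blast
qed

text \<open>The tensor that defines the cobracket of a dual bialgebra exists because \<open>\<beta>\<close> is the finite sum of the
  \<open>\<beta> b c\<close> times products of coordinate forms; it is unique because, by reflexivity, a tensor over the
  dual is determined by its values on evaluations.\<close>

lemma tensor_of_bilinear_form:
  assumes \<beta>: "bilinear_on \<beta>"
  shows "\<exists>!T. T \<in> tensor_square (dual_space E) \<and>
    (\<forall>x\<in>vcarrier E. \<forall>y\<in>vcarrier E. T (evaluation E x) (evaluation E y) = \<beta> x y)"
proof -
  interpret D: carrier_space "dual_space E" by (rule dual_carrier_space)
  have coord_D: "coord b \<in> vcarrier (dual_space E)" for b
    by (simp add: dual_space_def coord_dual)
  define T0 where "T0 = (\<Sum>b\<in>basis. \<Sum>c\<in>basis. tensor (dual_space E) (vscale (dual_space E) (\<beta> b c) (coord b)) (coord c))"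
  have mem: "T0 \<in> tensor_square (dual_space E)"
    unfolding T0_def by (intro D.tensor_square_sum D.tensor_square_tensor D.carrier_scale coord_D)
  have val: "T0 (evaluation E x) (evaluation E y) = \<beta> x y"
    if "x \<in> vcarrier E" "y \<in> vcarrier E" for x y
  proof -
    have "evaluation E x (vscale (dual_space E) (\<beta> b c) (coord b)) = \<beta> b c * coord b x" for b c
      using D.carrier_scale[OF coord_D] by (simp add: evaluation_def) (simp add: dual_space_def)
    then show ?thesis
      using that by (simp add: T0_def sum_apply D.tensor_dual evaluation_in_double_dual
          evaluation_dual coord_dual bilinear_expansion[OF \<beta> that] mult.assoc)
  qed
  have unique: "S = T"
    if S: "S \<in> tensor_square (dual_space E)" and T: "T \<in> tensor_square (dual_space E)"
      and eq: "\<forall>x\<in>vcarrier E. \<forall>y\<in>vcarrier E.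
        S (evaluation E x) (evaluation E y) = T (evaluation E x) (evaluation E y)" for S T
  proof (intro ext)
    fix \<Phi> \<Psi>
    have outside: "U \<Phi> \<Psi> = 0" if "U \<in> tensor_square (dual_space E)"
        "\<Phi> \<notin> dual_carrier (dual_space E) \<or> \<Psi> \<notin> dual_carrier (dual_space E)" for U
      by (subst D.tensor_decomp(2)[OF that(1)])
        (simp add: sum_list_apply case_prod_unfold D.tensor_outside[OF that(2)])
    show "S \<Phi> \<Psi> = T \<Phi> \<Psi>"
    proof (cases "\<Phi> \<in> dual_carrier (dual_space E) \<and> \<Psi> \<in> dual_carrier (dual_space E)")
      case True
      then obtain x y where "x \<in> vcarrier E" "\<Phi> = evaluation E x" "y \<in> vcarrier E" "\<Psi> = evaluation E y"
        by (metis double_dual)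
      then show ?thesis using eq by blast
    next
      case False
      then show ?thesis using outside[OF S] outside[OF T] by metis
    qed
  qed
  show ?thesis
  proof (rule ex1I[of _ T0])
    show "S = T0" if "S \<in> tensor_square (dual_space E) \<and>
      (\<forall>x\<in>vcarrier E. \<forall>y\<in>vcarrier E. S (evaluation E x) (evaluation E y) = \<beta> x y)" for S
      using that mem val by (intro unique) auto
  qed (use mem val in blast)
qed

text \<open>Contraction of two of the three factors, by which equations in the tensor cube become equations
  between scalars.\<close>

lemma contract3_first_two:
  assumes "bilinear_on \<beta>" "\<psi> \<in> dual_carrier E" "x \<in> vcarrier E" "y \<in> vcarrier E"
  shows "contract \<beta> (\<lambda>\<phi> \<chi>. tensor3 E x y z \<phi> \<chi> \<psi>) = \<beta> x y * \<psi> z"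
proof -
  have "contract \<beta> (\<lambda>\<phi> \<chi>. tensor3 E x y z \<phi> \<chi> \<psi>) = contract \<beta> (tensor E x y) * \<psi> z"
    using assms(2) by (simp add: contract_def tensor3_def tensor_def evaluation_dual sum_distrib_right mult.assoc)
  then show ?thesis using assms by (simp add: contract_tensor)
qed

lemma contract3_last_two:
  assumes "bilinear_on \<beta>" "\<phi> \<in> dual_carrier E" "y \<in> vcarrier E" "z \<in> vcarrier E"
  shows "contract \<beta> (tensor3 E x y z \<phi>) = \<phi> x * \<beta> y z"
proof -
  have "contract \<beta> (tensor3 E x y z \<phi>) = \<phi> x * contract \<beta> (tensor E y z)"
    using assms(2) by (simp add: contract_def tensor3_def tensor_def evaluation_dual sum_distrib_left mult_ac)
  then show ?thesis using assms by (simp add: contract_tensor)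
qed

end

section \<open>Lie brackets and the classical Yang--Baxter equation\<close>

locale finite_dimensional_lie_algebra = lie_algebra \<gg>
  for \<gg> :: "('k::field, 'v::ab_group_add, 'z) lie_alg_scheme" +
  assumes finite_spanning_set: "\<exists>B. finite B \<and> span B = vcarrier \<gg>"

sublocale finite_dimensional_lie_algebra \<subseteq> finite_dimensional_space \<gg>
  by unfold_locales (fact subspace_carrier, fact finite_spanning_set)

context finite_dimensional_lie_algebra
begin

abbreviation br :: "'v \<Rightarrow> 'v \<Rightarrow> 'v" ("\<lbrakk>_, _\<rbrakk>") where
  "\<lbrakk>x, y\<rbrakk> \<equiv> lie_bracket \<gg> x y"

lemma bracket_antisym:
  assumes "x \<in> vcarrier \<gg>" "y \<in> vcarrier \<gg>"
  shows "\<lbrakk>y, x\<rbrakk> = - \<lbrakk>x, y\<rbrakk>"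
proof -
  have "0 = \<lbrakk>x + y, x + y\<rbrakk>" using assms by (simp add: bracket_self carrier_add)
  also have "\<dots> = \<lbrakk>x, y\<rbrakk> + \<lbrakk>y, x\<rbrakk>"
    using assms by (subst bracket_add_left) (simp_all add: bracket_add_right carrier_add bracket_self)
  finally show ?thesis by (simp add: eq_neg_iff_add_eq_0 add.commute)
qed

text \<open>The Jacobi identity in the form "\<open>[x, -]\<close> is a derivation".\<close>

lemma bracket_derivation:
  assumes "x \<in> vcarrier \<gg>" "y \<in> vcarrier \<gg>" "z \<in> vcarrier \<gg>"
  shows "\<lbrakk>x, \<lbrakk>y, z\<rbrakk>\<rbrakk> = \<lbrakk>\<lbrakk>x, y\<rbrakk>, z\<rbrakk> + \<lbrakk>y, \<lbrakk>x, z\<rbrakk>\<rbrakk>"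
proof -
  have "\<lbrakk>y, \<lbrakk>z, x\<rbrakk>\<rbrakk> = - \<lbrakk>y, \<lbrakk>x, z\<rbrakk>\<rbrakk>"
  proof -
    have "\<lbrakk>y, - \<lbrakk>x, z\<rbrakk>\<rbrakk> = - \<lbrakk>y, \<lbrakk>x, z\<rbrakk>\<rbrakk>"
      using bracket_scale_right[of y "\<lbrakk>x, z\<rbrakk>" "-1"] assms by (simp add: bracket_closed)
    then show ?thesis using bracket_antisym[of x z] assms by simp
  qed
  moreover have "\<lbrakk>z, \<lbrakk>x, y\<rbrakk>\<rbrakk> = - \<lbrakk>\<lbrakk>x, y\<rbrakk>, z\<rbrakk>"
    using assms by (intro bracket_antisym bracket_closed)
  ultimately show ?thesis using jacobi[OF assms] by (simp add: algebra_simps)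
qed

lemma linear_on_bracket:
  assumes "linear_on \<phi>" "z \<in> vcarrier \<gg>"
  shows "linear_on (\<lambda>x. \<phi> \<lbrakk>x, z\<rbrakk>)" "linear_on (\<lambda>x. \<phi> \<lbrakk>z, x\<rbrakk>)"
  using assms unfolding linear_on_def
  by (simp_all add: bracket_closed bracket_add_left bracket_add_right bracket_scale_left
      bracket_scale_right)

lemma bilinear_on_bracket: "linear_on \<phi> \<Longrightarrow> bilinear_on (\<lambda>x y. \<phi> \<lbrakk>x, y\<rbrakk>)"
  by (simp add: bilinear_on_def linear_on_bracket)

text \<open>The form on \<open>\<gg> \<otimes> \<gg>\<close> obtained from \<open>\<phi> \<otimes> \<psi>\<close> by transposing the adjoint action of \<open>x\<close>.\<close>

definition ad_form :: "'v \<Rightarrow> ('v \<Rightarrow> 'k) \<Rightarrow> ('v \<Rightarrow> 'k) \<Rightarrow> 'v \<Rightarrow> 'v \<Rightarrow> 'k" where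
  "ad_form x \<phi> \<psi> = (\<lambda>a b. \<phi> \<lbrakk>x, a\<rbrakk> * \<psi> b + \<phi> a * \<psi> \<lbrakk>x, b\<rbrakk>)"

lemma bilinear_on_ad_form:
  assumes "x \<in> vcarrier \<gg>" "linear_on \<phi>" "linear_on \<psi>"
  shows "bilinear_on (ad_form x \<phi> \<psi>)"
  using assms unfolding bilinear_on_def linear_on_def ad_form_def
  by (simp add: bracket_closed bracket_add_right bracket_scale_right algebra_simps)

lemma ad_tensor_contract:
  assumes "x \<in> vcarrier \<gg>" "\<phi> \<in> dual_carrier \<gg>" "\<psi> \<in> dual_carrier \<gg>" "T \<in> tensor_square \<gg>"
  shows "ad_tensor \<gg> x T \<phi> \<psi> = contract (ad_form x \<phi> \<psi>) T"
proof -
  have "ad_tensor \<gg> x T \<phi> \<psi> = (\<Sum>(a, b)\<leftarrow>tensor_decomp \<gg> T. ad_form x \<phi> \<psi> a b)"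
    using assms by (simp add: ad_tensor_def tensor_lift_def sum_list_apply case_prod_unfold
        tensor_dual ad_form_def)
  also have "\<dots> = contract (ad_form x \<phi> \<psi>) T"
    using assms by (intro contract_decomp bilinear_on_ad_form dual_linear_on)
  finally show ?thesis .
qed

lemma linear_on_ad_tensor:
  assumes "\<phi> \<in> dual_carrier \<gg>" "\<psi> \<in> dual_carrier \<gg>" "T \<in> tensor_square \<gg>"
  shows "linear_on (\<lambda>x. ad_tensor \<gg> x T \<phi> \<psi>)"
proof -
  have \<phi>: "linear_on \<phi>" "linear_on \<psi>" using assms by (auto intro: dual_linear_on)
  have "ad_form (x + y) \<phi> \<psi> b c = ad_form x \<phi> \<psi> b c + ad_form y \<phi> \<psi> b c"
    if "x \<in> vcarrier \<gg>" "y \<in> vcarrier \<gg>" "b \<in> basis" "c \<in> basis" for x y b c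
    using \<phi> that unfolding linear_on_def ad_form_def
    by (simp add: bracket_closed bracket_add_left basis_carrier algebra_simps)
  moreover have "ad_form (vscale \<gg> k x) \<phi> \<psi> b c = k * ad_form x \<phi> \<psi> b c"
    if "x \<in> vcarrier \<gg>" "b \<in> basis" "c \<in> basis" for x k b c
    using \<phi> that unfolding linear_on_def ad_form_def
    by (simp add: bracket_closed bracket_scale_left basis_carrier algebra_simps)
  ultimately show ?thesis
    unfolding linear_on_def
    by (simp add: ad_tensor_contract assms carrier_add carrier_scale contract_def
        sum.distrib distrib_right sum_distrib_left mult.assoc)
qed

lemma CYB_contract_first_two:
  assumes T: "T \<in> tensor_square \<gg>" and \<beta>: "bilinear_on \<beta>" and \<psi>: "\<psi> \<in> dual_carrier \<gg>"
  shows "contract \<beta> (\<lambda>\<phi> \<chi>. CYB \<gg> T \<phi> \<chi> \<psi>) =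
    (\<Sum>(a, b)\<leftarrow>tensor_decomp \<gg> T. \<Sum>(c, d)\<leftarrow>tensor_decomp \<gg> T.
       \<beta> \<lbrakk>a, c\<rbrakk> b * \<psi> d + \<beta> a \<lbrakk>b, c\<rbrakk> * \<psi> d + \<beta> a c * \<psi> \<lbrakk>b, d\<rbrakk>)"
proof -
  let ?F = "\<lambda>S :: ('k, 'v) tensor3. contract \<beta> (\<lambda>\<phi> \<chi>. S \<phi> \<chi> \<psi>)"
  have add: "?F (R + S) = ?F R + ?F S" for R S
    by (simp add: contract_def algebra_simps sum.distrib)
  note L = tensor_decomp(1)[OF T]
  show ?thesis
    unfolding CYB_def tensor_lift_def case_prod_unfold
      additive_sum_list[of ?F, OF add] add
    using L by (intro arg_cong[where f = sum_list] map_cong refl)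
      (auto intro!: arg_cong2[where f = "(+)"] contract3_first_two \<beta> \<psi> bracket_closed
        dest!: subsetD[OF L])
qed

lemma CYB_contract_last_two:
  assumes T: "T \<in> tensor_square \<gg>" and \<beta>: "bilinear_on \<beta>" and \<phi>: "\<phi> \<in> dual_carrier \<gg>"
  shows "contract \<beta> (CYB \<gg> T \<phi>) =
    (\<Sum>(a, b)\<leftarrow>tensor_decomp \<gg> T. \<Sum>(c, d)\<leftarrow>tensor_decomp \<gg> T.
       \<phi> \<lbrakk>a, c\<rbrakk> * \<beta> b d + \<phi> a * \<beta> \<lbrakk>b, c\<rbrakk> d + \<phi> a * \<beta> c \<lbrakk>b, d\<rbrakk>)"
proof -
  let ?F = "\<lambda>S :: ('k, 'v) tensor3. contract \<beta> (S \<phi>)"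
  have add: "?F (R + S) = ?F R + ?F S" for R S
    by (simp add: contract_def algebra_simps sum.distrib)
  note L = tensor_decomp(1)[OF T]
  show ?thesis
    unfolding CYB_def tensor_lift_def case_prod_unfold
      additive_sum_list[of ?F, OF add] add
    using L by (intro arg_cong[where f = sum_list] map_cong refl)
      (auto intro!: arg_cong2[where f = "(+)"] contract3_last_two \<beta> \<phi> bracket_closed
        dest!: subsetD[OF L])
qed

text \<open>For \<open>T = r\<close> this is, up to sign, the first order term of the grouplike element \<open>u S(u)\<^sup>-\<^sup>1\<close> that
  implements the fourth power of the antipode in a quantization, \<open>u\<close> being the Drinfeld element.\<close>

definition bracket_sum :: "('k, 'v) tensor2 \<Rightarrow> 'v" where
  "bracket_sum T = tensor_lift \<gg> (lie_bracket \<gg>) T"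

lemma
  assumes T: "T \<in> tensor_square \<gg>"
  shows bracket_sum_carrier: "bracket_sum T \<in> vcarrier \<gg>"
    and bracket_sum_linear: "linear_on \<phi> \<Longrightarrow> \<phi> (bracket_sum T) = (\<Sum>(a, b)\<leftarrow>tensor_decomp \<gg> T. \<phi> \<lbrakk>a, b\<rbrakk>)"
proof -
  let ?bs = "map (\<lambda>(a, b). \<lbrakk>a, b\<rbrakk>) (tensor_decomp \<gg> T)"
  have eq: "bracket_sum T = sum_list ?bs" by (simp add: bracket_sum_def tensor_lift_def)
  have bs: "set ?bs \<subseteq> vcarrier \<gg>"
    using tensor_decomp(1)[OF T] by (auto intro: bracket_closed)
  show "bracket_sum T \<in> vcarrier \<gg>"
    unfolding eq by (rule linear_on_sum_list(1)[OF bs])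
  show "\<phi> (bracket_sum T) = (\<Sum>(a, b)\<leftarrow>tensor_decomp \<gg> T. \<phi> \<lbrakk>a, b\<rbrakk>)" if "linear_on \<phi>"
    unfolding eq linear_on_sum_list(2)[OF bs that]
    by (simp add: case_prod_unfold comp_def)
qed

lemma sum_list_cong_decomp:
  assumes "T \<in> tensor_square \<gg>"
    and "\<And>a b. a \<in> vcarrier \<gg> \<Longrightarrow> b \<in> vcarrier \<gg> \<Longrightarrow> f a b = g a b"
  shows "(\<Sum>(a, b)\<leftarrow>tensor_decomp \<gg> T. f a b) = (\<Sum>(a, b)\<leftarrow>tensor_decomp \<gg> T. g a b)"
  using tensor_decomp(1)[OF assms(1)] assms(2)
  by (intro arg_cong[where f = sum_list] map_cong) auto

text \<open>With \<open>r = \<Sum>a\<^sub>i \<otimes> b\<^sub>i\<close> and \<open>X = \<Sum>[a\<^sub>i, a\<^sub>j] \<otimes> [b\<^sub>i, b\<^sub>j]\<close>, bracketing the first two factors of the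
  Yang--Baxter equation gives \<open>[\<rho> \<otimes> 1, r] + X = 0\<close>: by Jacobi,
  \<open>[[a\<^sub>i, a\<^sub>j], b\<^sub>i] + [a\<^sub>i, [b\<^sub>i, a\<^sub>j]] = [[a\<^sub>i, b\<^sub>i], a\<^sub>j]\<close>.  Bracketing the last two gives \<open>X - [1 \<otimes> \<rho>, r] = 0\<close> in
  the same way, and the difference is \<open>[\<rho> \<otimes> 1 + 1 \<otimes> \<rho>, r] = 0\<close>.  Everything is paired with \<open>\<phi> \<otimes> \<psi>\<close>.\<close>

lemma bracket_sum_invariant:
  assumes T: "T \<in> tensor_square \<gg>" and CYB: "CYB \<gg> T = 0"
    and \<phi>: "\<phi> \<in> dual_carrier \<gg>" and \<psi>: "\<psi> \<in> dual_carrier \<gg>"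
  shows "contract (ad_form (bracket_sum T) \<phi> \<psi>) T = 0"
proof -
  let ?L = "tensor_decomp \<gg> T" and ?\<rho> = "bracket_sum T"
  note lin = dual_linear_on[OF \<phi>] dual_linear_on[OF \<psi>]
  have add: "\<phi> (x + y) = \<phi> x + \<phi> y" "\<psi> (x + y) = \<psi> x + \<psi> y"
    if "x \<in> vcarrier \<gg>" "y \<in> vcarrier \<gg>" for x y
    using lin that by (auto simp: linear_on_def)
  define X where "X = (\<Sum>(a, b)\<leftarrow>?L. \<Sum>(c, d)\<leftarrow>?L. \<phi> \<lbrakk>a, c\<rbrakk> * \<psi> \<lbrakk>b, d\<rbrakk>)"
  have first: "(\<Sum>(c, d)\<leftarrow>?L. \<phi> \<lbrakk>?\<rho>, c\<rbrakk> * \<psi> d) + X = 0"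
  proof -
    have "(\<Sum>(c, d)\<leftarrow>?L. \<phi> \<lbrakk>?\<rho>, c\<rbrakk> * \<psi> d) =
        (\<Sum>(c, d)\<leftarrow>?L. (\<Sum>(a, b)\<leftarrow>?L. \<phi> \<lbrakk>\<lbrakk>a, b\<rbrakk>, c\<rbrakk> * \<psi> d))"
      by (rule sum_list_cong_decomp[OF T])
        (simp add: bracket_sum_linear[OF T linear_on_bracket(1)[OF lin(1)]] sum_list_mult_const
          case_prod_unfold)
    also have "\<dots> = (\<Sum>(a, b)\<leftarrow>?L. \<Sum>(c, d)\<leftarrow>?L. \<phi> \<lbrakk>\<lbrakk>a, b\<rbrakk>, c\<rbrakk> * \<psi> d)"
      unfolding case_prod_unfold by (rule sum_list_swap)
    finally have "(\<Sum>(c, d)\<leftarrow>?L. \<phi> \<lbrakk>?\<rho>, c\<rbrakk> * \<psi> d) + X =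
        (\<Sum>(a, b)\<leftarrow>?L. \<Sum>(c, d)\<leftarrow>?L. \<phi> \<lbrakk>\<lbrakk>a, b\<rbrakk>, c\<rbrakk> * \<psi> d + \<phi> \<lbrakk>a, c\<rbrakk> * \<psi> \<lbrakk>b, d\<rbrakk>)"
      by (simp add: X_def sum_list_addf case_prod_unfold)
    also have "\<dots> = (\<Sum>(a, b)\<leftarrow>?L. \<Sum>(c, d)\<leftarrow>?L.
        \<phi> \<lbrakk>\<lbrakk>a, c\<rbrakk>, b\<rbrakk> * \<psi> d + \<phi> \<lbrakk>a, \<lbrakk>b, c\<rbrakk>\<rbrakk> * \<psi> d + \<phi> \<lbrakk>a, c\<rbrakk> * \<psi> \<lbrakk>b, d\<rbrakk>)"
    proof (intro sum_list_cong_decomp[OF T])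
      fix a b c d
      assume abcd: "a \<in> vcarrier \<gg>" "b \<in> vcarrier \<gg>" "c \<in> vcarrier \<gg>" "d \<in> vcarrier \<gg>"
      have "\<lbrakk>\<lbrakk>a, c\<rbrakk>, b\<rbrakk> + \<lbrakk>a, \<lbrakk>b, c\<rbrakk>\<rbrakk> = \<lbrakk>\<lbrakk>a, b\<rbrakk>, c\<rbrakk>"
        using bracket_derivation[of a b c] bracket_antisym[of b "\<lbrakk>a, c\<rbrakk>"] abcd
        by (simp add: bracket_closed)
      then have "\<phi> \<lbrakk>\<lbrakk>a, c\<rbrakk>, b\<rbrakk> + \<phi> \<lbrakk>a, \<lbrakk>b, c\<rbrakk>\<rbrakk> = \<phi> \<lbrakk>\<lbrakk>a, b\<rbrakk>, c\<rbrakk>"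
        using add(1) abcd by (metis bracket_closed)
      then show "\<phi> \<lbrakk>\<lbrakk>a, b\<rbrakk>, c\<rbrakk> * \<psi> d + \<phi> \<lbrakk>a, c\<rbrakk> * \<psi> \<lbrakk>b, d\<rbrakk> =
        \<phi> \<lbrakk>\<lbrakk>a, c\<rbrakk>, b\<rbrakk> * \<psi> d + \<phi> \<lbrakk>a, \<lbrakk>b, c\<rbrakk>\<rbrakk> * \<psi> d + \<phi> \<lbrakk>a, c\<rbrakk> * \<psi> \<lbrakk>b, d\<rbrakk>"
        by (simp flip: distrib_right)
    qed
    also have "\<dots> = contract (\<lambda>x y. \<phi> \<lbrakk>x, y\<rbrakk>) (\<lambda>\<phi> \<chi>. CYB \<gg> T \<phi> \<chi> \<psi>)"
      by (rule CYB_contract_first_two[OF T bilinear_on_bracket[OF lin(1)] \<psi>, symmetric])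
    finally show ?thesis by (simp add: CYB contract_def)
  qed
  have last: "X - (\<Sum>(a, b)\<leftarrow>?L. \<phi> a * \<psi> \<lbrakk>?\<rho>, b\<rbrakk>) = 0"
  proof -
    have "- (\<Sum>(a, b)\<leftarrow>?L. \<phi> a * \<psi> \<lbrakk>?\<rho>, b\<rbrakk>) = (\<Sum>(a, b)\<leftarrow>?L. - (\<phi> a * \<psi> \<lbrakk>?\<rho>, b\<rbrakk>))"
      by (simp add: uminus_sum_list_map comp_def case_prod_unfold)
    also have "\<dots> = (\<Sum>(a, b)\<leftarrow>?L. \<Sum>(c, d)\<leftarrow>?L. \<phi> a * \<psi> \<lbrakk>b, \<lbrakk>c, d\<rbrakk>\<rbrakk>)"
    proof (rule sum_list_cong_decomp[OF T])
      fix a b assume ab: "a \<in> vcarrier \<gg>" "b \<in> vcarrier \<gg>"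
      have "\<psi> \<lbrakk>b, ?\<rho>\<rbrakk> + \<psi> \<lbrakk>?\<rho>, b\<rbrakk> = \<psi> 0"
      proof -
        have "\<psi> (\<lbrakk>b, ?\<rho>\<rbrakk> + \<lbrakk>?\<rho>, b\<rbrakk>) = \<psi> \<lbrakk>b, ?\<rho>\<rbrakk> + \<psi> \<lbrakk>?\<rho>, b\<rbrakk>"
          by (intro add bracket_closed ab bracket_sum_carrier[OF T])
        moreover have "\<lbrakk>b, ?\<rho>\<rbrakk> + \<lbrakk>?\<rho>, b\<rbrakk> = 0"
          using bracket_antisym[OF ab(2) bracket_sum_carrier[OF T]] by simp
        ultimately show ?thesis by simp
      qed
      then have "- \<psi> \<lbrakk>?\<rho>, b\<rbrakk> = \<psi> \<lbrakk>b, ?\<rho>\<rbrakk>"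
        using linear_on_0[OF lin(2)] by (simp add: eq_neg_iff_add_eq_0 neg_eq_iff_add_eq_0 add.commute)
      also have "\<dots> = (\<Sum>(c, d)\<leftarrow>?L. \<psi> \<lbrakk>b, \<lbrakk>c, d\<rbrakk>\<rbrakk>)"
        by (rule bracket_sum_linear[OF T linear_on_bracket(2)[OF lin(2) ab(2)]])
      finally have "- (\<phi> a * \<psi> \<lbrakk>?\<rho>, b\<rbrakk>) = \<phi> a * (\<Sum>(c, d)\<leftarrow>?L. \<psi> \<lbrakk>b, \<lbrakk>c, d\<rbrakk>\<rbrakk>)"
        by (metis mult_minus_right)
      then show "- (\<phi> a * \<psi> \<lbrakk>?\<rho>, b\<rbrakk>) = (\<Sum>(c, d)\<leftarrow>?L. \<phi> a * \<psi> \<lbrakk>b, \<lbrakk>c, d\<rbrakk>\<rbrakk>)"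
        by (simp add: sum_list_const_mult case_prod_unfold)
    qed
    finally have "X - (\<Sum>(a, b)\<leftarrow>?L. \<phi> a * \<psi> \<lbrakk>?\<rho>, b\<rbrakk>) = (\<Sum>(a, b)\<leftarrow>?L. \<Sum>(c, d)\<leftarrow>?L.
        \<phi> \<lbrakk>a, c\<rbrakk> * \<psi> \<lbrakk>b, d\<rbrakk> + \<phi> a * \<psi> \<lbrakk>b, \<lbrakk>c, d\<rbrakk>\<rbrakk>)"
      unfolding X_def diff_conv_add_uminus by (simp add: sum_list_addf case_prod_unfold)
    also have "\<dots> = (\<Sum>(a, b)\<leftarrow>?L. \<Sum>(c, d)\<leftarrow>?L.
        \<phi> \<lbrakk>a, c\<rbrakk> * \<psi> \<lbrakk>b, d\<rbrakk> + \<phi> a * \<psi> \<lbrakk>\<lbrakk>b, c\<rbrakk>, d\<rbrakk> + \<phi> a * \<psi> \<lbrakk>c, \<lbrakk>b, d\<rbrakk>\<rbrakk>)"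
    proof (intro sum_list_cong_decomp[OF T])
      fix a b c d
      assume "a \<in> vcarrier \<gg>" "b \<in> vcarrier \<gg>" "c \<in> vcarrier \<gg>" "d \<in> vcarrier \<gg>"
      then have "\<psi> \<lbrakk>b, \<lbrakk>c, d\<rbrakk>\<rbrakk> = \<psi> \<lbrakk>\<lbrakk>b, c\<rbrakk>, d\<rbrakk> + \<psi> \<lbrakk>c, \<lbrakk>b, d\<rbrakk>\<rbrakk>"
        using bracket_derivation[of b c d] by (simp add: add bracket_closed)
      then show "\<phi> \<lbrakk>a, c\<rbrakk> * \<psi> \<lbrakk>b, d\<rbrakk> + \<phi> a * \<psi> \<lbrakk>b, \<lbrakk>c, d\<rbrakk>\<rbrakk> =
        \<phi> \<lbrakk>a, c\<rbrakk> * \<psi> \<lbrakk>b, d\<rbrakk> + \<phi> a * \<psi> \<lbrakk>\<lbrakk>b, c\<rbrakk>, d\<rbrakk> + \<phi> a * \<psi> \<lbrakk>c, \<lbrakk>b, d\<rbrakk>\<rbrakk>"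
        by (simp add: distrib_left)
    qed
    also have "\<dots> = contract (\<lambda>x y. \<psi> \<lbrakk>x, y\<rbrakk>) (CYB \<gg> T \<phi>)"
      by (rule CYB_contract_last_two[OF T bilinear_on_bracket[OF lin(2)] \<phi>, symmetric])
    finally show ?thesis by (simp add: CYB contract_def)
  qed
  have "contract (ad_form ?\<rho> \<phi> \<psi>) T = (\<Sum>(a, b)\<leftarrow>?L. \<phi> \<lbrakk>?\<rho>, a\<rbrakk> * \<psi> b + \<phi> a * \<psi> \<lbrakk>?\<rho>, b\<rbrakk>)"
    using contract_decomp[OF bilinear_on_ad_form[OF bracket_sum_carrier[OF T] lin] T]
    by (simp add: ad_form_def)
  also have "\<dots> = (\<Sum>(a, b)\<leftarrow>?L. \<phi> \<lbrakk>?\<rho>, a\<rbrakk> * \<psi> b) + (\<Sum>(a, b)\<leftarrow>?L. \<phi> a * \<psi> \<lbrakk>?\<rho>, b\<rbrakk>)"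
    by (simp add: sum_list_addf case_prod_unfold)
  also have "\<dots> = 0" using first last by (simp add: eq_neg_iff_add_eq_0)
  finally show ?thesis .
qed

end

section \<open>The dual of a quasitriangular Lie bialgebra\<close>

text \<open>\<open>\<gg>\<^sup>*\<close> is given a name of its own so that it is used only through the explicit description of its
  operations in \<open>dual_of_quasitriangular_sel\<close>.\<close>

definition dual_of_quasitriangular ::
    "('k::field, 'v::ab_group_add) lie_alg \<Rightarrow> ('k, 'v) tensor2 \<Rightarrow> ('k, 'v \<Rightarrow> 'k) lie_bialg" where
  "dual_of_quasitriangular \<gg> r = dual_bialg (quasitriangular_bialg \<gg> r)"

abbreviation antisymmetrize :: "('k::field, 'v) tensor2 \<Rightarrow> ('k, 'v) tensor2" where
  "antisymmetrize r \<equiv> (\<lambda>\<phi> \<psi>. (r \<phi> \<psi> - flip r \<phi> \<psi>) / 2)"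

lemma dual_carrier_quasitriangular_bialg:
  "dual_carrier (quasitriangular_bialg \<gg> r) = dual_carrier \<gg>"
  by (simp add: dual_carrier_def quasitriangular_bialg_def)

lemma dual_space_quasitriangular_bialg:
  "dual_space (quasitriangular_bialg \<gg> r) = dual_space \<gg>"
  by (simp add: dual_space_def dual_carrier_quasitriangular_bialg)

lemma evaluation_quasitriangular_bialg:
  "evaluation (quasitriangular_bialg \<gg> r) = evaluation \<gg>"
  by (simp add: evaluation_def dual_carrier_quasitriangular_bialg fun_eq_iff)

lemma dual_of_quasitriangular_sel:
  "vcarrier (dual_of_quasitriangular \<gg> r) = dual_carrier \<gg>"
  "vscale (dual_of_quasitriangular \<gg> r) = (\<lambda>c \<phi> x. c * \<phi> x)"
  "lie_bracket (dual_of_quasitriangular \<gg> r) = (\<lambda>\<phi> \<psi> x.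
     if x \<in> vcarrier \<gg> then ad_tensor \<gg> x (antisymmetrize r) \<phi> \<psi> else 0)"
  "lie_cobracket (dual_of_quasitriangular \<gg> r) = (\<lambda>\<chi>. THE T. T \<in> tensor_square (dual_space \<gg>) \<and>
     (\<forall>x\<in>vcarrier \<gg>. \<forall>y\<in>vcarrier \<gg>.
        T (evaluation \<gg> x) (evaluation \<gg> y) = \<chi> (lie_bracket \<gg> x y)))"
  by (simp_all add: dual_of_quasitriangular_def dual_bialg_def dual_space_quasitriangular_bialg
      evaluation_quasitriangular_bialg)
    (simp_all add: dual_space_def quasitriangular_bialg_def cong: if_cong)

lemma tensor_decomp_dual_of_quasitriangular:
  "tensor_decomp (dual_of_quasitriangular \<gg> r) = tensor_decomp (dual_space \<gg>)"
proof -
  have carrier: "vcarrier (dual_of_quasitriangular \<gg> r) = vcarrier (dual_space \<gg>)"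
    and scale: "vscale (dual_of_quasitriangular \<gg> r) = vscale (dual_space \<gg>)"
    by (simp_all add: dual_of_quasitriangular_sel) (simp_all add: dual_space_def)
  have "dual_carrier (dual_of_quasitriangular \<gg> r) = dual_carrier (dual_space \<gg>)"
    by (simp add: dual_carrier_def[of "dual_of_quasitriangular \<gg> r"]
        dual_carrier_def[of "dual_space \<gg>"] carrier scale)
  then have "tensor (dual_of_quasitriangular \<gg> r) = tensor (dual_space \<gg>)"
    by (simp add: tensor_def evaluation_def fun_eq_iff)
  then show ?thesis
    by (intro ext) (simp add: tensor_decomp_def carrier)
qed

locale finite_dimensional_r_matrix = finite_dimensional_lie_algebra \<gg>
  for \<gg> :: "('k::field_char_0, 'v::ab_group_add) lie_alg" +
  fixes r :: "('k, 'v) tensor2"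
  assumes r_tensor: "r \<in> tensor_square \<gg>"
    and yang_baxter: "CYB \<gg> r = 0"
begin

abbreviation \<rho> :: 'v where "\<rho> \<equiv> bracket_sum r"
abbreviation \<aa> :: "('k, 'v \<Rightarrow> 'k) lie_bialg" where "\<aa> \<equiv> dual_of_quasitriangular \<gg> r"

lemmas s_tensor = tensor_square_antisymmetrize[OF r_tensor]

text \<open>The bracket is antisymmetric, so the bracket of \<open>(r - r\<^sup>2\<^sup>1) / 2\<close> equals that of \<open>r\<close>.\<close>

lemma contract_bracket_antisymmetrize:
  assumes "linear_on \<phi>"
  shows "contract (\<lambda>a b. \<phi> \<lbrakk>a, b\<rbrakk>) (antisymmetrize r) = \<phi> \<rho>"
proof -
  have neg: "\<phi> (- x) = - \<phi> x" if "x \<in> vcarrier \<gg>" for x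
  proof -
    have "\<phi> (vscale \<gg> (-1) x) = - 1 * \<phi> x" using assms that unfolding linear_on_def by blast
    then show ?thesis by simp
  qed
  have "contract (\<lambda>a b. \<phi> \<lbrakk>b, a\<rbrakk>) r = (\<Sum>b\<in>basis. \<Sum>c\<in>basis. - (\<phi> \<lbrakk>b, c\<rbrakk> * r (coord b) (coord c)))"
    unfolding contract_def
  proof (intro sum.cong refl)
    fix b c assume bc: "b \<in> basis" "c \<in> basis"
    show "\<phi> \<lbrakk>c, b\<rbrakk> * r (coord b) (coord c) = - (\<phi> \<lbrakk>b, c\<rbrakk> * r (coord b) (coord c))"
      using bracket_antisym[of b c] neg[of "\<lbrakk>b, c\<rbrakk>"] bc by (simp add: basis_carrier bracket_closed)
  qed
  also have "\<dots> = - contract (\<lambda>a b. \<phi> \<lbrakk>a, b\<rbrakk>) r"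
    by (simp add: contract_def sum_negf)
  finally have "contract (\<lambda>a b. \<phi> \<lbrakk>a, b\<rbrakk>) (antisymmetrize r) = contract (\<lambda>a b. \<phi> \<lbrakk>a, b\<rbrakk>) r"
    by (simp add: contract_antisymmetrize)
  also have "\<dots> = \<phi> \<rho>"
    using contract_decomp[OF bilinear_on_bracket[OF assms] r_tensor] bracket_sum_linear[OF r_tensor assms]
    by simp
  finally show ?thesis .
qed

text \<open>Invariance of \<open>r\<close> under \<open>\<rho>\<close> passes to \<open>r\<^sup>2\<^sup>1\<close> by exchanging \<open>\<phi>\<close> and \<open>\<psi>\<close>, hence to the tensor that defines
  the cobracket.  Dually, \<open>\<phi> \<mapsto> \<phi> \<rho>\<close> is a character of \<open>\<gg>\<^sup>*\<close>.\<close>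

lemma cobracket_bracket_sum_zero:
  assumes \<phi>: "\<phi> \<in> dual_carrier \<gg>" and \<psi>: "\<psi> \<in> dual_carrier \<gg>"
  shows "ad_tensor \<gg> \<rho> (antisymmetrize r) \<phi> \<psi> = 0"
proof -
  have swap: "(\<lambda>a b. ad_form \<rho> \<phi> \<psi> b a) = ad_form \<rho> \<psi> \<phi>"
    by (simp add: ad_form_def fun_eq_iff)
  have "ad_tensor \<gg> \<rho> (antisymmetrize r) \<phi> \<psi> =
      (contract (ad_form \<rho> \<phi> \<psi>) r - contract (ad_form \<rho> \<psi> \<phi>) r) / 2"
    using assms by (simp add: ad_tensor_contract bracket_sum_carrier r_tensor s_tensor
        contract_antisymmetrize swap)
  then show ?thesis
    using bracket_sum_invariant[OF r_tensor yang_baxter] assms by simp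
qed

lemma dual_bracket_in_dual:
  assumes "\<phi> \<in> dual_carrier \<gg>" "\<psi> \<in> dual_carrier \<gg>"
  shows "lie_bracket \<aa> \<phi> \<psi> \<in> dual_carrier \<gg>"
  using linear_on_ad_tensor[OF assms s_tensor]
  by (simp add: dual_of_quasitriangular_sel linear_on_def dual_carrier_def carrier_add carrier_scale)

lemma dual_cobracket:
  assumes "\<chi> \<in> dual_carrier \<gg>"
  shows "lie_cobracket \<aa> \<chi> \<in> tensor_square (dual_space \<gg>)"
    and "\<And>x y. x \<in> vcarrier \<gg> \<Longrightarrow> y \<in> vcarrier \<gg> \<Longrightarrow>
      lie_cobracket \<aa> \<chi> (evaluation \<gg> x) (evaluation \<gg> y) = \<chi> \<lbrakk>x, y\<rbrakk>"
  using theI'[OF tensor_of_bilinear_form[OF bilinear_on_bracket[OF dual_linear_on[OF assms]]]]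
  unfolding dual_of_quasitriangular_sel by blast+

lemma dual_cobracket_decomp:
  assumes \<chi>: "\<chi> \<in> dual_carrier \<gg>"
  shows "set (tensor_decomp \<aa> (lie_cobracket \<aa> \<chi>)) \<subseteq> dual_carrier \<gg> \<times> dual_carrier \<gg>"
    and "\<And>x y. x \<in> vcarrier \<gg> \<Longrightarrow> y \<in> vcarrier \<gg> \<Longrightarrow>
      (\<Sum>(\<phi>, \<psi>)\<leftarrow>tensor_decomp \<aa> (lie_cobracket \<aa> \<chi>). \<phi> x * \<psi> y) = \<chi> \<lbrakk>x, y\<rbrakk>"
proof -
  interpret D: carrier_space "dual_space \<gg>" by (rule dual_carrier_space)
  define T xs where "T = lie_cobracket \<aa> \<chi>" and "xs = tensor_decomp (dual_space \<gg>) T"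
  have xs: "set xs \<subseteq> dual_carrier \<gg> \<times> dual_carrier \<gg>" "T = (\<Sum>(\<phi>, \<psi>)\<leftarrow>xs. tensor (dual_space \<gg>) \<phi> \<psi>)"
    using D.tensor_decomp[OF dual_cobracket(1)[OF \<chi>]]
    by (simp_all only: xs_def T_def) (simp add: dual_space_def)
  then show "set (tensor_decomp \<aa> (lie_cobracket \<aa> \<chi>)) \<subseteq> dual_carrier \<gg> \<times> dual_carrier \<gg>"
    by (simp add: tensor_decomp_dual_of_quasitriangular xs_def T_def)
  fix x y assume xy: "x \<in> vcarrier \<gg>" "y \<in> vcarrier \<gg>"
  have "\<chi> \<lbrakk>x, y\<rbrakk> = T (evaluation \<gg> x) (evaluation \<gg> y)"
    using dual_cobracket(2)[OF \<chi> xy] by (simp add: T_def)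
  also have "\<dots> = (\<Sum>p\<leftarrow>xs. evaluation \<gg> x (fst p) * evaluation \<gg> y (snd p))"
    unfolding xs(2) using xy
    by (simp add: sum_list_apply case_prod_unfold D.tensor_dual evaluation_in_double_dual)
  also have "\<dots> = (\<Sum>(\<phi>, \<psi>)\<leftarrow>xs. \<phi> x * \<psi> y)"
    unfolding case_prod_unfold
    by (intro arg_cong[where f = sum_list] map_cong refl)
      (auto simp: evaluation_dual dest!: subsetD[OF xs(1)])
  finally show "(\<Sum>(\<phi>, \<psi>)\<leftarrow>tensor_decomp \<aa> (lie_cobracket \<aa> \<chi>). \<phi> x * \<psi> y) = \<chi> \<lbrakk>x, y\<rbrakk>"
    by (simp add: tensor_decomp_dual_of_quasitriangular xs_def T_def)
qed

text \<open>\<open>D\<close> of the dual is the transpose of \<open>D\<close> of \<open>\<gg>\<close>.  For \<open>s = (r - r\<^sup>2\<^sup>1) / 2 = \<Sum>a \<otimes> b\<close> the latter maps \<open>x\<close> to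
  \<open>\<Sum>[[x, a], b] + [a, [x, b]] = [x, \<Sum>[a, b]] = [x, \<rho>]\<close>.\<close>

lemma dual_lie_D:
  assumes \<chi>: "\<chi> \<in> dual_carrier \<gg>"
  shows "lie_D \<aa> \<chi> = (\<lambda>x. if x \<in> vcarrier \<gg> then \<chi> \<lbrakk>x, \<rho>\<rbrakk> else 0)"
proof
  fix x
  let ?M = "tensor_decomp \<aa> (lie_cobracket \<aa> \<chi>)" and ?s = "antisymmetrize r"
  let ?S = "tensor_decomp \<gg> ?s"
  note M = dual_cobracket_decomp[OF \<chi>] and lin = dual_linear_on[OF \<chi>]
  have D: "lie_D \<aa> \<chi> x = (\<Sum>(\<phi>, \<psi>)\<leftarrow>?M. lie_bracket \<aa> \<phi> \<psi> x)"
    by (simp add: lie_D_def tensor_lift_def sum_list_apply case_prod_unfold)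
  show "lie_D \<aa> \<chi> x = (if x \<in> vcarrier \<gg> then \<chi> \<lbrakk>x, \<rho>\<rbrakk> else 0)"
  proof (cases "x \<in> vcarrier \<gg>")
    case False
    then show ?thesis by (simp add: D dual_of_quasitriangular_sel case_prod_unfold)
  next
    case x: True
    have "lie_D \<aa> \<chi> x = (\<Sum>(\<phi>, \<psi>)\<leftarrow>?M. \<Sum>(a, b)\<leftarrow>?S. ad_form x \<phi> \<psi> a b)"
      unfolding D case_prod_unfold
    proof (intro arg_cong[where f = sum_list] map_cong refl)
      fix p assume "p \<in> set ?M"
      then have p: "fst p \<in> dual_carrier \<gg>" "snd p \<in> dual_carrier \<gg>"
        by (auto dest!: subsetD[OF M(1)])
      show "lie_bracket \<aa> (fst p) (snd p) x = (\<Sum>q\<leftarrow>?S. ad_form x (fst p) (snd p) (fst q) (snd q))"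
        using x p contract_decomp[OF bilinear_on_ad_form[OF x dual_linear_on[OF p(1)]
            dual_linear_on[OF p(2)]] s_tensor]
        by (simp add: dual_of_quasitriangular_sel ad_tensor_contract s_tensor case_prod_unfold)
    qed
    also have "\<dots> = (\<Sum>(a, b)\<leftarrow>?S. \<Sum>(\<phi>, \<psi>)\<leftarrow>?M. \<phi> \<lbrakk>x, a\<rbrakk> * \<psi> b + \<phi> a * \<psi> \<lbrakk>x, b\<rbrakk>)"
      unfolding case_prod_unfold ad_form_def by (rule sum_list_swap)
    also have "\<dots> = (\<Sum>(a, b)\<leftarrow>?S. \<chi> \<lbrakk>x, \<lbrakk>a, b\<rbrakk>\<rbrakk>)"
    proof (rule sum_list_cong_decomp[OF s_tensor])
      fix a b assume ab: "a \<in> vcarrier \<gg>" "b \<in> vcarrier \<gg>"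
      have "(\<Sum>(\<phi>, \<psi>)\<leftarrow>?M. \<phi> \<lbrakk>x, a\<rbrakk> * \<psi> b + \<phi> a * \<psi> \<lbrakk>x, b\<rbrakk>) = \<chi> \<lbrakk>\<lbrakk>x, a\<rbrakk>, b\<rbrakk> + \<chi> \<lbrakk>a, \<lbrakk>x, b\<rbrakk>\<rbrakk>"
        using M(2)[of "\<lbrakk>x, a\<rbrakk>" b] M(2)[of a "\<lbrakk>x, b\<rbrakk>"] x ab
        by (simp add: sum_list_addf case_prod_unfold bracket_closed)
      also have "\<dots> = \<chi> (\<lbrakk>\<lbrakk>x, a\<rbrakk>, b\<rbrakk> + \<lbrakk>a, \<lbrakk>x, b\<rbrakk>\<rbrakk>)"
        using lin x ab by (simp add: linear_on_def bracket_closed)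
      finally show "(\<Sum>(\<phi>, \<psi>)\<leftarrow>?M. \<phi> \<lbrakk>x, a\<rbrakk> * \<psi> b + \<phi> a * \<psi> \<lbrakk>x, b\<rbrakk>) = \<chi> \<lbrakk>x, \<lbrakk>a, b\<rbrakk>\<rbrakk>"
        by (simp only: bracket_derivation[OF x ab])
    qed
    also have "\<dots> = contract (\<lambda>a b. \<chi> \<lbrakk>x, \<lbrakk>a, b\<rbrakk>\<rbrakk>) ?s"
      using contract_decomp[OF bilinear_on_bracket[OF linear_on_bracket(2)[OF lin x]] s_tensor] .
    also have "\<dots> = \<chi> \<lbrakk>x, \<rho>\<rbrakk>"
      by (rule contract_bracket_antisymmetrize[OF linear_on_bracket(2)[OF lin x]])
    finally show ?thesis using x by simp
  qed
qed

text \<open>Pairing the first factor of the cobracket of \<open>\<chi>\<close> with \<open>\<rho>\<close> gives \<open>x \<mapsto> \<chi> [\<rho>, x]\<close>, which is the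
  previous formula up to the sign.\<close>

lemma dual_lie_D_character:
  assumes \<chi>: "\<chi> \<in> dual_carrier \<gg>"
  shows "lie_D \<aa> \<chi> = (\<Sum>(\<phi>, \<psi>)\<leftarrow>tensor_decomp \<aa> (lie_cobracket \<aa> \<chi>). vscale \<aa> (- \<phi> \<rho>) \<psi>)"
proof
  fix x
  let ?M = "tensor_decomp \<aa> (lie_cobracket \<aa> \<chi>)"
  note M = dual_cobracket_decomp[OF \<chi>] and \<rho> = bracket_sum_carrier[OF r_tensor]
  have "(\<Sum>(\<phi>, \<psi>)\<leftarrow>?M. vscale \<aa> (- \<phi> \<rho>) \<psi>) x = - (\<Sum>(\<phi>, \<psi>)\<leftarrow>?M. \<phi> \<rho> * \<psi> x)"
    by (simp add: sum_list_apply case_prod_unfold dual_of_quasitriangular_sel uminus_sum_list_map comp_def)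
  also have "\<dots> = (if x \<in> vcarrier \<gg> then \<chi> \<lbrakk>x, \<rho>\<rbrakk> else 0)"
  proof (cases "x \<in> vcarrier \<gg>")
    case True
    have "\<chi> (\<lbrakk>\<rho>, x\<rbrakk> + \<lbrakk>x, \<rho>\<rbrakk>) = \<chi> \<lbrakk>\<rho>, x\<rbrakk> + \<chi> \<lbrakk>x, \<rho>\<rbrakk>"
      using dual_linear_on[OF \<chi>] True \<rho> unfolding linear_on_def by (blast intro: bracket_closed)
    moreover have "\<lbrakk>\<rho>, x\<rbrakk> + \<lbrakk>x, \<rho>\<rbrakk> = 0"
      using bracket_antisym[OF \<rho> True] by simp
    ultimately have "\<chi> \<lbrakk>x, \<rho>\<rbrakk> = - \<chi> \<lbrakk>\<rho>, x\<rbrakk>"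
      using linear_on_0[OF dual_linear_on[OF \<chi>]] by (simp add: eq_neg_iff_add_eq_0 add.commute)
    then show ?thesis using M(2)[OF \<rho> True] True by simp
  next
    case False
    have "(\<Sum>(\<phi>, \<psi>)\<leftarrow>?M. \<phi> \<rho> * \<psi> x) = (\<Sum>(\<phi>, \<psi>)\<leftarrow>?M. 0)"
      using M(1) False by (intro arg_cong[where f = sum_list] map_cong) (auto simp: dual_carrier_def)
    then show ?thesis using False by (simp add: case_prod_unfold)
  qed
  finally show "lie_D \<aa> \<chi> x = (\<Sum>(\<phi>, \<psi>)\<leftarrow>?M. vscale \<aa> (- \<phi> \<rho>) \<psi>) x"
    by (simp add: dual_lie_D[OF \<chi>])
qed

lemma dual_D_hamiltonian:
  "\<exists>h\<in>uea_dual \<aa>. \<forall>f\<in>uea_dual \<aa>. dual_uea_D \<aa> f = poisson_bracket \<aa> h f"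
proof (intro bexI ballI)
  let ?\<eta> = "\<lambda>\<phi> :: 'v \<Rightarrow> 'k. - \<phi> \<rho>"
  interpret D: carrier_space "dual_space \<gg>" by (rule dual_carrier_space)
  have closed: "0 \<in> vcarrier \<aa>"
      "\<And>\<phi> \<psi>. \<phi> \<in> vcarrier \<aa> \<Longrightarrow> \<psi> \<in> vcarrier \<aa> \<Longrightarrow> \<phi> + \<psi> \<in> vcarrier \<aa>"
      "\<And>c \<phi>. \<phi> \<in> vcarrier \<aa> \<Longrightarrow> vscale \<aa> c \<phi> \<in> vcarrier \<aa>"
    using D.carrier_intros
    by (simp_all only: dual_of_quasitriangular_sel) (simp_all add: dual_space_def)
  show "primitive_form \<aa> ?\<eta> \<in> uea_dual \<aa>"
  proof (rule primitive_form_in_uea_dual[OF closed(2,3)])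
    fix \<phi> \<psi> assume "\<phi> \<in> vcarrier \<aa>" "\<psi> \<in> vcarrier \<aa>"
    then have *: "\<phi> \<in> dual_carrier \<gg>" "\<psi> \<in> dual_carrier \<gg>"
      by (simp_all add: dual_of_quasitriangular_sel)
    show "lie_bracket \<aa> \<phi> \<psi> \<in> vcarrier \<aa>"
      using dual_bracket_in_dual[OF *] by (simp add: dual_of_quasitriangular_sel)
    show "?\<eta> (lie_bracket \<aa> \<phi> \<psi>) = 0"
      using cobracket_bracket_sum_zero[OF *] by (simp add: dual_of_quasitriangular_sel)
  qed (simp_all add: dual_of_quasitriangular_sel)
  fix f assume f: "f \<in> uea_dual \<aa>"
  show "dual_uea_D \<aa> f = poisson_bracket \<aa> (primitive_form \<aa> ?\<eta>) f"
  proof (rule hamiltonian_of_character[OF closed _ _ f])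
    fix \<chi> assume "\<chi> \<in> vcarrier \<aa>"
    then have \<chi>: "\<chi> \<in> dual_carrier \<gg>" by (simp add: dual_of_quasitriangular_sel)
    show "set (tensor_decomp \<aa> (lie_cobracket \<aa> \<chi>)) \<subseteq> vcarrier \<aa> \<times> vcarrier \<aa>"
      using dual_cobracket_decomp(1)[OF \<chi>] by (simp add: dual_of_quasitriangular_sel)
    show "lie_D \<aa> \<chi> = (\<Sum>(\<phi>, \<psi>)\<leftarrow>tensor_decomp \<aa> (lie_cobracket \<aa> \<chi>). vscale \<aa> (?\<eta> \<phi>) \<psi>)"
      by (rule dual_lie_D_character[OF \<chi>])
  qed
qed

end

theorem proposition9p1:
  fixes \<gg> :: "('k::field_char_0, 'v::ab_group_add) lie_alg" and r :: "('k, 'v) tensor2"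
  assumes "nondegenerate_quasitriangular_lie_bialgebra \<gg> r"
  shows "\<exists>h \<in> uea_dual (dual_bialg (quasitriangular_bialg \<gg> r)).
           \<forall>f \<in> uea_dual (dual_bialg (quasitriangular_bialg \<gg> r)).
             dual_uea_D (dual_bialg (quasitriangular_bialg \<gg> r)) f
               = poisson_bracket (dual_bialg (quasitriangular_bialg \<gg> r)) h f"
proof -
  interpret nondegenerate_quasitriangular_lie_bialgebra \<gg> r by (rule assms)
  interpret finite_dimensional_r_matrix \<gg> r
    by unfold_locales (fact finite_dimensional r_tensor classical_yang_baxter)+
  show ?thesis
    using dual_D_hamiltonian by (simp only: dual_of_quasitriangular_def)
qed

end
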